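(* Let $\Omega^h\in\mathcal{A}_{\mathrm{AD}}$ be an adapted family of connection $1$-forms whose reduced operator is $$P^{N,k}=(h\partial)^{N-1}-kqh^{k-1}\bigl(k\partial+(k-1)\bigr)\cdots\bigl(k\partial+2\bigr)\bigl(k\partial+1\bigr).$$ If $\Omega^h$ is $h^{-1}$-linear (i.e. $h\Omega^h$ is independent of $h$), then $\Omega^h=\hat\Omega^h$, where $\hat\Omega^h=(L_-)^{-1}dL_-$ is the family of connection $1$-forms obtained by Birkhoff factorization from the Picard-Fuchs connection form $\Omega^h_{\mathrm{PF}}$.
   Context: Fix integers $N\ge 5$ and $k\ge 1$ with $N>k$. Let $t$ be the coordinate on $\mathbb{C}$, $q=e^t$, $\partial=\partial/\partial t=q\,\partial/\partial q$ (so $dq=q\,dt$), and let $h$ be a parameter (a loop parameter, $h\in S^1\subset\mathbb{C}$). Grade polynomials in $q$ and $h$ (and their products with powers of $h^{-1}$) by $\deg h=2$, $\deg q=2(N-k)$. Matrices are $(N-1)\times(N-1)$ complex matrices, with rows and columns indexed by $0,\dots,N-2$. For an integer $n$, the $n$-diagonal component of a matrix $(a_{i,j})$ is the part consisting of the entries with $j-i=n$. A matrix-valued function $A$ of $q,h$ is homogeneous if for every $n$ each nonzero entry of its $n$-diagonal component is homogeneous of degree $2n$. Let $I_{-1}$ be the matrix whose $(i+1,i)$ entries are $1$ and whose other entries are $0$. The adapted gauge group $\mathcal{G}_{\mathrm{AD}}$ is the group of $U=U(q,h)$ such that: $U$ is a matrix-valued polynomial in $q$ and $h$ with invertible values (for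 $q=e^t$, $t\in\mathbb{C}$, $h\in S^1$); $U$ is homogeneous; and $U|_{q=0}=I$. An adapted family of connection $1$-forms is $\Omega^h=\frac1h R^h(q)\,dt$ where $R^h(q)$ is a matrix-valued polynomial in $q$ and $h$ such that: $\frac1h R^h(q)$ is homogeneous; $R^h(0)=I_{-1}$; and the $(-1)$-diagonal component of $R^h(q)$ is $I_{-1}$. The set of these is $\mathcal{A}_{\mathrm{AD}}$. Reduced operator: given $\Omega^h=\frac1h(r_{\alpha,\beta})_{0\le\alpha,\beta\le N-2}\,dt\in\mathcal{A}_{\mathrm{AD}}$, define differential operators by $P_0=1$ and $P_{\beta+1}=(h\partial)P_\beta-\sum_{\alpha=0}^{\beta}r_{\alpha,\beta}P_\alpha$ for $\beta=0,\dots,N-2$ (products are compositions of operators, so $(h\partial)q=q(h\partial)+hq$). The reduced operator of $\Omega^h$ is $P_{N-1}$. Picard-Fuchs connection form: let $\mathcal{M}^h=\mathcal{D}/(P^{N,k})$, where $\mathcal{D}$ is the ring of differential operators generated by $h\partial$ over polynomials in $q$ with coefficients rational functions of $h$, and $(P^{N,k})$ is the left ideal generated by $P^{N,k}$. The classes of $1,h\partial,\dots,(h\partial)^{N-2}$ form a basis, and $\Omega^h_{\mathrm{PF}}=\frac1h R^h_{\mathrm{PF}}(q)\,dt$, where $R^h_{\mathrm{PF}}$ is the matrix defined by $h\partial\,([1],[h\partial],\dots,[(h\partial)^{N-2}])=([1],[h\partial],\dots,[(h\partial)^{N-2}])\,R^h_{\mathrm{PF}}(q)$. Birkhoff factorization: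 let $L$ be a map from a nonempty open set $V\subset\mathbb{C}$ to the loop group $\Lambda GL(\mathbb{C}^{N-1})$ (smooth maps $S^1\to GL(\mathbb{C}^{N-1})$ in the variable $h$) with $L^{-1}dL=\Omega^h_{\mathrm{PF}}$, and let $L=L_-L_+$ be its Birkhoff factorization, where $L_-$ extends holomorphically to $1<|h|\le\infty$ with $L_-|_{h=\infty}=I$ and $L_+$ extends holomorphically to $|h|<1$; $L$ is chosen so that this factorization exists and $L_+\in\mathcal{G}_{\mathrm{AD}}$. Then $\hat\Omega^h=(L_-)^{-1}dL_-=L_+\Omega^h_{\mathrm{PF}}L_+^{-1}+L_+d(L_+^{-1})$. *)

theory Defs
  imports
    "HOL-Analysis.Analysis"
    "HOL-Computational_Algebra.Computational_Algebra"
    "Jordan_Normal_Form.Matrix"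
    "Jordan_Normal_Form.Gauss_Jordan_Elimination"
begin

section \<open>Polynomial matrices in q and h\<close>

text \<open>A polynomial in q and h is an element of C[h][q], i.e. of type complex poly poly: the outer
  variable is q, the inner one is h. So coeff (coeff p a) b is the coefficient of q^a h^b.\<close>

type_synonym qh_poly = "complex poly poly"

definition eval_qh :: "qh_poly \<Rightarrow> complex \<Rightarrow> complex \<Rightarrow> complex" where
  "eval_qh p q h = poly (poly p [:q:]) h"

definition eval_mat :: "qh_poly mat \<Rightarrow> complex \<Rightarrow> complex \<Rightarrow> complex mat" where
  "eval_mat A q h = map_mat (\<lambda>p. eval_qh p q h) A"

definition at_q0 :: "qh_poly mat \<Rightarrow> complex poly mat" where
  "at_q0 A = map_mat (\<lambda>p. poly p 0) A"

text \<open>The Laurent polynomial h^s p (s an integer) is homogeneous of degree d,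
  where deg h = 2 and deg q = 2 (N - k).\<close>

definition homogeneous_of_degree :: "nat \<Rightarrow> nat \<Rightarrow> int \<Rightarrow> qh_poly \<Rightarrow> int \<Rightarrow> bool" where
  "homogeneous_of_degree N k s p d \<longleftrightarrow>
     (\<forall>a b. coeff (coeff p a) b \<noteq> 0 \<longrightarrow>
        2 * (int N - int k) * int a + 2 * (int b + s) = d)"

definition diagonal_part :: "int \<Rightarrow> 'a :: zero mat \<Rightarrow> 'a mat" where
  "diagonal_part n A = Matrix.mat (dim_row A) (dim_col A)
     (\<lambda>(i, j). if int j - int i = n then A $$ (i, j) else 0)"

text \<open>The matrix h^s A is homogeneous.\<close>

definition homogeneous_mat :: "nat \<Rightarrow> nat \<Rightarrow> int \<Rightarrow> qh_poly mat \<Rightarrow> bool" where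
  "homogeneous_mat N k s A \<longleftrightarrow>
     (\<forall>n. \<forall>i < dim_row A. \<forall>j < dim_col A. diagonal_part n A $$ (i, j) \<noteq> 0 \<longrightarrow>
        homogeneous_of_degree N k s (diagonal_part n A $$ (i, j)) (2 * n))"

definition I_minus1 :: "nat \<Rightarrow> 'a :: zero_neq_one mat" where
  "I_minus1 n = Matrix.mat n n (\<lambda>(i, j). if i = j + 1 then 1 else 0)"

section \<open>The adapted gauge group and adapted connection forms\<close>

definition gauge_group_AD :: "nat \<Rightarrow> nat \<Rightarrow> qh_poly mat set" where
  "gauge_group_AD N k =
     {U \<in> carrier_mat (N - 1) (N - 1).
        (\<forall>t. \<forall>h \<in> sphere 0 1. invertible_mat (eval_mat U (exp t) h)) \<and>
        homogeneous_mat N k 0 U \<and>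
        at_q0 U = 1\<^sub>m (N - 1)}"

text \<open>An adapted form (1/h) R dt is represented by its polynomial matrix R.\<close>

definition adapted_forms :: "nat \<Rightarrow> nat \<Rightarrow> qh_poly mat set" where
  "adapted_forms N k =
     {R \<in> carrier_mat (N - 1) (N - 1).
        homogeneous_mat N k (- 1) R \<and>
        at_q0 R = I_minus1 (N - 1) \<and>
        diagonal_part (- 1) R = I_minus1 (N - 1)}"

text \<open>The coefficient of dt in (1/h) R dt, at q = e^t.\<close>

definition connection_form :: "qh_poly mat \<Rightarrow> complex \<Rightarrow> complex \<Rightarrow> complex mat" where
  "connection_form R t h = (1 / h) \<cdot>\<^sub>m eval_mat R (exp t) h"

definition h_inverse_linear :: "qh_poly mat \<Rightarrow> bool" where
  "h_inverse_linear R \<longleftrightarrow>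
     (\<forall>t. \<forall>h \<in> sphere 0 1. \<forall>h' \<in> sphere 0 1.
        h \<cdot>\<^sub>m connection_form R t h = h' \<cdot>\<^sub>m connection_form R t h')"

section \<open>Differential operators\<close>

text \<open>Let K = C(h). Differential operators generated by h d/dt and K[q] (with q = e^t, so
  d/dt = q d/dq) are realised as C(h)-linear maps on K[q]. Composition of maps is the product of
  operators, and no information is lost since K[q] is a faithful module: see
  \<open>h_partial_mult_q\<close> and \<open>operators_faithful\<close> below.\<close>

type_synonym ratq = "complex poly fract poly"
type_synonym dop = "ratq \<Rightarrow> ratq"

definition coef :: "qh_poly \<Rightarrow> ratq" where
  "coef p = map_poly to_fract p"

abbreviation q_var :: qh_poly where "q_var \<equiv> [:0, 1:]"
abbreviation h_var :: qh_poly where "h_var \<equiv> [:[:0, 1:]:]"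

definition partial_t :: dop where
  "partial_t f = coef q_var * pderiv f"

definition h_partial :: dop where
  "h_partial f = coef h_var * partial_t f"

inductive_set diffops :: "dop set" where
  mult: "(\<lambda>f. a * f) \<in> diffops"
| h_partial: "h_partial \<in> diffops"
| add: "A \<in> diffops \<Longrightarrow> B \<in> diffops \<Longrightarrow> (\<lambda>f. A f + B f) \<in> diffops"
| comp: "A \<in> diffops \<Longrightarrow> B \<in> diffops \<Longrightarrow> A \<circ> B \<in> diffops"

text \<open>The class of A in the quotient of diffops by the left ideal generated by P.\<close>

definition left_ideal :: "dop \<Rightarrow> dop set" where
  "left_ideal P = {Q \<circ> P | Q. Q \<in> diffops}"

definition op_class :: "dop \<Rightarrow> dop \<Rightarrow> dop set" where
  "op_class P A = {B \<in> diffops. (\<lambda>f. B f - A f) \<in> left_ideal P}"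

fun reduced_seq :: "qh_poly mat \<Rightarrow> nat \<Rightarrow> dop" where
  "reduced_seq R 0 = id"
| "reduced_seq R (Suc \<beta>) =
     (\<lambda>f. h_partial (reduced_seq R \<beta> f) -
          (\<Sum>\<alpha>\<le>\<beta>. coef (R $$ (\<alpha>, \<beta>)) * reduced_seq R \<alpha> f))"

definition reduced_operator :: "nat \<Rightarrow> qh_poly mat \<Rightarrow> dop" where
  "reduced_operator N R = reduced_seq R (N - 1)"

text \<open>The list \<open>rev [1..<k]\<close> is k-1, ..., 2, 1, so the product below is
  (k d/dt + (k-1)) ... (k d/dt + 2) (k d/dt + 1); it is the identity for k = 1.\<close>

definition P_op :: "nat \<Rightarrow> nat \<Rightarrow> dop" where
  "P_op N k = (\<lambda>f. (h_partial ^^ (N - 1)) f -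
     coef (of_nat k * q_var * h_var ^ (k - 1)) *
       foldr (\<circ>) (map (\<lambda>j f. of_nat k * partial_t f + of_nat j * f) (rev [1..<k])) id f)"

lemma coef_mult: "coef (p * r) = coef p * coef r"
  unfolding coef_def
  by (rule poly_eqI) (simp add: coeff_map_poly coeff_mult to_fract_sum)

lemma h_partial_mult_q:
  "h_partial (coef q_var * f) = coef q_var * h_partial f + coef (h_var * q_var) * f"
proof -
  have q: "coef q_var = [:0, 1:]"
    by (rule poly_eqI) (auto simp: coef_def coeff_map_poly coeff_pCons split: nat.splits)
  show ?thesis
    unfolding h_partial_def partial_t_def coef_mult
    by (simp add: q pderiv_mult pderiv_pCons algebra_simps)
qed

lemma h_partial_monom: "h_partial (monom 1 m) = [:to_fract [:0, of_nat m:]:] * monom 1 m"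
proof -
  have q: "coef q_var = monom 1 1"
    by (rule poly_eqI) (auto simp: coef_def coeff_map_poly coeff_pCons split: nat.splits)
  have h: "coef h_var = [:to_fract [:0, 1:]:]"
    by (rule poly_eqI) (auto simp: coef_def coeff_map_poly coeff_pCons split: nat.splits)
  have "(of_nat m :: complex poly fract) * to_fract [:0, 1:] = to_fract [:0, of_nat m:]"
  proof -
    have "of_nat m = to_fract (of_nat m :: complex poly)"
      by (induction m) (auto simp: to_fract_add)
    then show ?thesis by (simp add: of_nat_poly flip: to_fract_mult)
  qed
  then show ?thesis
    unfolding h_partial_def partial_t_def q h
    by (cases m) (auto simp: pderiv_monom mult_monom smult_monom mult.commute)
qed

lemma h_partial_pow_monom:
  "(h_partial ^^ i) (monom 1 m) = [:to_fract [:0, of_nat m:]:] ^ i * monom 1 m"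
proof (induction i)
  case (Suc i)
  have sm: "h_partial ([:c:] * f) = [:c:] * h_partial f" for c f
    by (simp add: h_partial_def partial_t_def pderiv_smult)
  have "[:c:] ^ i = [:c ^ i:]" for c :: "complex poly fract"
    by (simp add: poly_const_pow)
  then show ?case using Suc by (simp add: h_partial_monom sm del: mult_pCons_left) 
qed simp

lemma operators_faithful:
  assumes "\<And>f. (\<Sum>i<n. a i * (h_partial ^^ i) f) = 0" and "i < n"
  shows "a i = (0 :: ratq)"
proof -
  define F :: "ratq poly" where "F = (\<Sum>i<n. monom (a i) i)"
  have root: "poly F [:to_fract [:0, of_nat m:]:] = 0" for m
  proof -
    have "(\<Sum>i<n. a i * [:to_fract [:0, of_nat m:]:] ^ i) * monom 1 m = 0"
      using assms(1)[of "monom 1 m"] unfolding h_partial_pow_monom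
      by (simp add: sum_distrib_right mult.assoc)
    then have "(\<Sum>i<n. a i * [:to_fract [:0, of_nat m:]:] ^ i) = 0" by simp
    then show ?thesis by (simp add: F_def poly_sum poly_monom)
  qed
  have "inj (\<lambda>m::nat. [:to_fract [:0, of_nat m :: complex:]:])"
    by (auto simp: inj_on_def)
  then have "infinite (range (\<lambda>m::nat. [:to_fract [:0, of_nat m :: complex:]:]))"
    using finite_imageD infinite_UNIV_nat by blast
  moreover have "range (\<lambda>m::nat. [:to_fract [:0, of_nat m :: complex:]:]) \<subseteq> {x. poly F x = 0}"
    using root by auto
  ultimately have "F = 0" using poly_roots_finite finite_subset by blast
  then have "coeff F i = 0" by simp
  then show ?thesis using assms(2) by (simp add: F_def coeff_sum)
qed

section \<open>The Picard-Fuchs connection form\<close>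

text \<open>In column j: h d/dt [(h d/dt)^j] is the sum over i of R(i,j) [(h d/dt)^i] in the quotient
  module, whose operations are those of representatives.\<close>

definition is_PF_matrix :: "nat \<Rightarrow> nat \<Rightarrow> qh_poly mat \<Rightarrow> bool" where
  "is_PF_matrix N k R \<longleftrightarrow>
     R \<in> carrier_mat (N - 1) (N - 1) \<and>
     (\<forall>j < N - 1.
        op_class (P_op N k) (h_partial \<circ> (h_partial ^^ j)) =
        op_class (P_op N k) (\<lambda>f. \<Sum>i < N - 1. coef (R $$ (i, j)) * (h_partial ^^ i) f))"

definition PF_matrix :: "nat \<Rightarrow> nat \<Rightarrow> qh_poly mat" where
  "PF_matrix N k = (THE R. is_PF_matrix N k R)"

section \<open>Loop groups and Birkhoff factorization\<close>

text \<open>Loops are functions of h of which only the values on the unit circle matter.\<close>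

definition smooth_path :: "(real \<Rightarrow> complex) \<Rightarrow> bool" where
  "smooth_path f \<longleftrightarrow>
     (\<exists>F. F 0 = f \<and> (\<forall>(n::nat) x. (F n has_vector_derivative F (Suc n) x) (at x)))"

definition loop_group :: "nat \<Rightarrow> (complex \<Rightarrow> complex mat) set" where
  "loop_group n =
     {\<gamma>. (\<forall>h \<in> sphere 0 1. \<gamma> h \<in> carrier_mat n n \<and> invertible_mat (\<gamma> h)) \<and>
          (\<forall>i < n. \<forall>j < n. smooth_path (\<lambda>\<theta>. \<gamma> (cis \<theta>) $$ (i, j)))}"

text \<open>\<open>\<gamma>\<close> is the boundary value on the unit circle of a GL(n)-valued map that is continuous on
  \<open>S\<close> and holomorphic in the interior of \<open>S\<close>.\<close>

definition extends_hol :: "nat \<Rightarrow> complex set \<Rightarrow> (complex \<Rightarrow> complex mat) \<Rightarrow>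
    (complex \<Rightarrow> complex mat) \<Rightarrow> bool" where
  "extends_hol n S \<gamma> F \<longleftrightarrow>
     (\<forall>h \<in> sphere 0 1. F h = \<gamma> h) \<and>
     (\<forall>h \<in> S. F h \<in> carrier_mat n n \<and> invertible_mat (F h)) \<and>
     (\<forall>i < n. \<forall>j < n. continuous_on S (\<lambda>h. F h $$ (i, j)) \<and>
                      (\<lambda>h. F h $$ (i, j)) holomorphic_on interior S)"

text \<open>Holomorphy of the first factor at infinity, with value the identity there, is expressed by
  the limit: a singularity with finite limit is removable.\<close>

definition birkhoff_factorization :: "nat \<Rightarrow> (complex \<Rightarrow> complex mat) \<Rightarrow>
    (complex \<Rightarrow> complex mat) \<Rightarrow> (complex \<Rightarrow> complex mat) \<Rightarrow> bool" where
  "birkhoff_factorization n \<gamma> \<gamma>m \<gamma>p \<longleftrightarrow>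
     \<gamma> \<in> loop_group n \<and> \<gamma>m \<in> loop_group n \<and> \<gamma>p \<in> loop_group n \<and>
     (\<forall>h \<in> sphere 0 1. \<gamma> h = \<gamma>m h * \<gamma>p h) \<and>
     (\<exists>F. extends_hol n {h. 1 \<le> norm h} \<gamma>m F \<and>
          (\<forall>i < n. \<forall>j < n.
             ((\<lambda>h. F h $$ (i, j)) \<longlongrightarrow> 1\<^sub>m n $$ (i, j)) at_infinity)) \<and>
     (\<exists>F. extends_hol n (cball 0 1) \<gamma>p F)"

definition mat_deriv :: "(complex \<Rightarrow> complex mat) \<Rightarrow> complex \<Rightarrow> complex mat" where
  "mat_deriv A t = Matrix.mat (dim_row (A t)) (dim_col (A t)) (\<lambda>(i, j). deriv (\<lambda>s. A s $$ (i, j)) t)"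

text \<open>The coefficient of dt in A^(-1) dA.\<close>

definition log_deriv :: "(complex \<Rightarrow> complex mat) \<Rightarrow> complex \<Rightarrow> complex mat" where
  "log_deriv A t = the (mat_inverse (A t)) * mat_deriv A t"

text \<open>L^(-1) dL = (1/h) R dt on V, for a differentiable map L from V to the loop group.\<close>

definition integrates_form :: "nat \<Rightarrow> complex set \<Rightarrow> (complex \<Rightarrow> complex \<Rightarrow> complex mat) \<Rightarrow>
    qh_poly mat \<Rightarrow> bool" where
  "integrates_form n V L R \<longleftrightarrow>
     (\<forall>t \<in> V. L t \<in> loop_group n) \<and>
     (\<forall>t \<in> V. \<forall>h \<in> sphere 0 1.
        (\<forall>i < n. \<forall>j < n. (\<lambda>s. L s h $$ (i, j)) field_differentiable at t) \<and>
        log_deriv (\<lambda>s. L s h) t = connection_form R t h)"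

end

theory Submission
  imports Defs "HOL-Complex_Analysis.Complex_Analysis"
begin

text \<open>Put \<open>n = N - 1\<close>, and let \<open>P\<close> be the Picard-Fuchs matrix. The operators \<open>P_\<beta>\<close> of the reduction procedure,
  expanded in powers of \<open>h \<partial>\<close>, give a matrix \<open>T\<close> of polynomials in \<open>q\<close> and \<open>h\<close>. It is
  upper unitriangular and equals \<open>1\<close> at \<open>q = 0\<close>. Since the last operator \<open>P_n\<close> is \<open>P^(N,k)\<close>, which is zero in the
  Picard-Fuchs module, the classes of \<open>P_0, ..., P_(n-1)\<close> form a basis in which \<open>h \<partial>\<close> acts by \<open>R\<close>; in
  other words \<open>P T + h dT/dt = T R\<close> (lemma \<open>reduced_coeff_intertwines\<close>, which uses the companion form of
  \<open>P\<close> from \<open>PF_matrix_companion\<close>). Hence the frame \<open>H = L T\<close> satisfies \<open>H^(-1) dH = (1/h) R dt\<close>.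

  With the Birkhoff factorization \<open>L = Lm U\<close> this reads \<open>H = Lm W\<close>, where \<open>W = U T\<close> is
  polynomial in \<open>q\<close> and \<open>h\<close> and equals \<open>1\<close> at \<open>q = 0\<close>. The theorem says that \<open>Lm^(-1) dLm = (1/h) R dt\<close>,
  so it suffices that \<open>W = 1\<close> (lemma \<open>identity_if_normalized_at_infinity\<close>). Because \<open>R\<close> does not depend
  on \<open>h\<close>, the equation for \<open>H\<close> can be solved by a power series in \<open>1/h\<close>: near a point \<open>t0\<close> there is
  \<open>Z(t, 1/h)\<close>, equal to \<open>1\<close> at \<open>h = \<infinity>\<close>, with \<open>H(t) Z(t, 1/h) = H(t0)\<close>. So
  \<open>Lm(t) W(t) Z(t, 1/h) = Lm(t0) W(t0)\<close> on the circle \<open>norm h = 1\<close>. Both sides extend to the outside of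
  the circle, where they must agree by the maximum principle. Let \<open>d\<close> be the degree of \<open>W\<close> in \<open>h\<close>. Division by
  \<open>h ^ d\<close> and the limit \<open>h \<rightarrow> \<infinity>\<close> show that the coefficient of \<open>h ^ d\<close> in \<open>W\<close> takes the same value at \<open>t\<close>
  and at \<open>t0\<close>. It is a polynomial in \<open>q\<close>, hence constant, and is determined by \<open>W = 1\<close> at \<open>q = 0\<close>.
  For \<open>d > 0\<close> it would be zero, against the choice of \<open>d\<close>; so \<open>d = 0\<close> and \<open>W = 1\<close>.\<close>

section \<open>Differential operators in normal form\<close>

lemma coeff_coef: "coeff (coef p) i = to_fract (coeff p i)"
  by (simp add: coef_def coeff_map_poly)

lemma coef_0: "coef 0 = 0" and coef_1: "coef 1 = 1"
  by (rule poly_eqI; simp add: coeff_coef coeff_1)+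

lemma coef_add: "coef (p + r) = coef p + coef r"
  by (rule poly_eqI) (simp add: coeff_coef to_fract_add)

lemma coef_minus: "coef (- p) = - coef p"
  by (rule poly_eqI) (simp add: coeff_coef to_fract_uminus)

lemma coef_diff: "coef (p - r) = coef p - coef r"
  using coef_add[of p "- r"] by (simp add: coef_minus)

lemma coef_sum: "coef (sum p I) = (\<Sum>i\<in>I. coef (p i))"
  by (induction I rule: infinite_finite_induct) (simp_all add: coef_0 coef_add)

lemma coef_of_nat: "coef (of_nat m) = of_nat m"
  by (induction m) (simp_all add: coef_0 coef_1 coef_add)

lemma coef_eq_iff: "coef p = coef r \<longleftrightarrow> p = r"
  by (auto simp: poly_eq_iff coeff_coef)

lemma h_partial_0: "h_partial 0 = 0"
  by (simp add: h_partial_def partial_t_def)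

lemma h_partial_add: "h_partial (f + g) = h_partial f + h_partial g"
  by (simp add: h_partial_def partial_t_def pderiv_add algebra_simps)

lemma h_partial_sum: "h_partial (sum g I) = (\<Sum>i\<in>I. h_partial (g i))"
  by (induction I rule: infinite_finite_induct) (simp_all add: h_partial_0 h_partial_add)

lemma h_partial_mult: "h_partial (a * f) = h_partial a * f + a * h_partial f"
  by (simp add: h_partial_def partial_t_def pderiv_mult algebra_simps)

lemma h_partial_coef: "h_partial (coef p) = coef (h_var * q_var * pderiv p)"
proof -
  have "pderiv (coef p) = coef (pderiv p)"
  proof -
    have "of_nat m = to_fract (of_nat m :: complex poly)" for m
      by (induction m) (auto simp: to_fract_add)
    then show ?thesis
      by (intro poly_eqI) (simp add: coeff_coef coeff_pderiv del: of_nat_Suc)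
  qed
  then show ?thesis
    by (simp only: h_partial_def partial_t_def coef_mult mult.assoc)
qed

text \<open>Operators are compared through their expansions in powers of \<open>h_partial\<close>. The coefficients range
  over a subring \<open>S\<close> of \<open>\<complex>(h)[q]\<close>: all of it when an unknown element of a left ideal is expanded,
  and the polynomials in \<open>q\<close> and \<open>h\<close> when the entries of a connection matrix are to be read off.\<close>

definition differential_subring :: "ratq set \<Rightarrow> bool" where
  "differential_subring S \<longleftrightarrow> 0 \<in> S \<and> 1 \<in> S \<and>
     (\<forall>a\<in>S. \<forall>b\<in>S. a + b \<in> S \<and> a * b \<in> S) \<and> (\<forall>a\<in>S. h_partial a \<in> S)"

definition order_below :: "ratq set \<Rightarrow> nat \<Rightarrow> dop \<Rightarrow> bool" where
  "order_below S m A \<longleftrightarrow>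
     (\<exists>c. (\<forall>i. c i \<in> S) \<and> (\<forall>f. A f = (\<Sum>i<m. c i * (h_partial ^^ i) f)))"

lemma order_belowE:
  assumes "order_below S m A"
  obtains c where "\<And>i. c i \<in> S" "\<And>f. A f = (\<Sum>i<m. c i * (h_partial ^^ i) f)"
  using assms unfolding order_below_def by blast

lemma differential_subring_UNIV: "differential_subring UNIV"
  by (simp add: differential_subring_def)

lemma differential_subring_coef: "differential_subring (range coef)"
proof -
  have "0 \<in> range coef" "1 \<in> range coef"
    using coef_0 coef_1 by (metis rangeI)+
  moreover have "coef p + coef r \<in> range coef" "coef p * coef r \<in> range coef"
    "h_partial (coef p) \<in> range coef" for p r
    by (simp_all only: coef_add[symmetric] coef_mult[symmetric] h_partial_coef rangeI)
  ultimately show ?thesis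
    unfolding differential_subring_def by blast
qed

lemma order_below_mono:
  assumes S: "differential_subring S" and "order_below S m A" "m \<le> m'"
  shows "order_below S m' A"
proof -
  obtain c where c: "\<And>i. c i \<in> S" "\<And>f. A f = (\<Sum>i<m. c i * (h_partial ^^ i) f)"
    using assms(2) by (auto simp: order_below_def)
  have "A f = (\<Sum>i<m'. (if i < m then c i else 0) * (h_partial ^^ i) f)" for f
    unfolding c using assms(3) by (intro sum.mono_neutral_cong_left) auto
  moreover have "(if i < m then c i else 0) \<in> S" for i
    using S c by (auto simp: differential_subring_def)
  ultimately show ?thesis
    unfolding order_below_def by (intro exI[of _ "\<lambda>i. if i < m then c i else 0"]) auto
qed

lemma order_below_add:
  assumes S: "differential_subring S" and "order_below S m A" "order_below S m B"
  shows "order_below S m (\<lambda>f. A f + B f)"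
proof -
  obtain a b where "\<And>i. a i \<in> S" "\<And>f. A f = (\<Sum>i<m. a i * (h_partial ^^ i) f)"
    "\<And>i. b i \<in> S" "\<And>f. B f = (\<Sum>i<m. b i * (h_partial ^^ i) f)"
    using assms(2,3) by (auto simp: order_below_def)
  then show ?thesis
    using S unfolding order_below_def differential_subring_def
    by (intro exI[of _ "\<lambda>i. a i + b i"]) (auto simp: sum.distrib algebra_simps)
qed

lemma order_below_mult:
  assumes S: "differential_subring S" and "order_below S m A" "a \<in> S"
  shows "order_below S m (\<lambda>f. a * A f)"
proof -
  obtain c where "\<And>i. c i \<in> S" "\<And>f. A f = (\<Sum>i<m. c i * (h_partial ^^ i) f)"
    using assms(2) by (auto simp: order_below_def)
  then show ?thesis
    using S \<open>a \<in> S\<close> unfolding order_below_def differential_subring_def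
    by (intro exI[of _ "\<lambda>i. a * c i"]) (auto simp: sum_distrib_left mult.assoc)
qed

lemma order_below_h_partial:
  assumes S: "differential_subring S" and "order_below S m A"
  shows "order_below S (Suc m) (\<lambda>f. h_partial (A f))"
proof -
  obtain c where c: "\<And>i. c i \<in> S" "\<And>f. A f = (\<Sum>i<m. c i * (h_partial ^^ i) f)"
    using assms(2) by (auto simp: order_below_def)
  have "order_below S (Suc m) (\<lambda>f. \<Sum>i<m. h_partial (c i) * (h_partial ^^ i) f)"
  proof (rule order_below_mono[OF S])
    show "order_below S m (\<lambda>f. \<Sum>i<m. h_partial (c i) * (h_partial ^^ i) f)"
      unfolding order_below_def
      using S c(1) by (intro exI[of _ "\<lambda>i. h_partial (c i)"]) (simp add: differential_subring_def)
  qed simp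
  moreover have "order_below S (Suc m) (\<lambda>f. \<Sum>i<m. c i * (h_partial ^^ Suc i) f)"
  proof -
    have "(\<Sum>i<m. c i * (h_partial ^^ Suc i) f) =
        (\<Sum>i<Suc m. (case i of 0 \<Rightarrow> 0 | Suc i \<Rightarrow> c i) * (h_partial ^^ i) f)" for f
      by (subst sum.lessThan_Suc_shift) simp
    moreover have "(case i of 0 \<Rightarrow> 0 | Suc i \<Rightarrow> c i) \<in> S" for i
      using S c by (auto simp: differential_subring_def split: nat.split)
    ultimately show ?thesis
      unfolding order_below_def
      by (intro exI[of _ "\<lambda>i. case i of 0 \<Rightarrow> 0 | Suc i \<Rightarrow> c i"]) auto
  qed
  ultimately have "order_below S (Suc m) (\<lambda>f. (\<Sum>i<m. h_partial (c i) * (h_partial ^^ i) f) +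
      (\<Sum>i<m. c i * (h_partial ^^ Suc i) f))"
    by (rule order_below_add[OF S])
  then show ?thesis
    by (simp add: c h_partial_sum h_partial_mult sum.distrib)
qed

lemma order_below_h_partial_power:
  assumes S: "differential_subring S"
  shows "order_below S m A \<Longrightarrow> order_below S (m + i) (\<lambda>f. (h_partial ^^ i) (A f))"
  by (induction i) (use order_below_h_partial[OF S] in auto)

lemma order_below_id:
  assumes S: "differential_subring S"
  shows "order_below S 1 (\<lambda>f. f)"
  using S unfolding order_below_def differential_subring_def by (auto intro: exI[of _ "\<lambda>_. 1"])

lemma order_below_0: "differential_subring S \<Longrightarrow> order_below S m (\<lambda>f. 0)"
  unfolding order_below_def differential_subring_def by (auto intro: exI[of _ "\<lambda>_. 0"])

lemma order_below_sum:
  assumes S: "differential_subring S" and "\<And>i. i < l \<Longrightarrow> order_below S m (A i)"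
  shows "order_below S m (\<lambda>f. \<Sum>i<(l::nat). A i f)"
  using assms(2)
  by (induction l) (auto intro!: order_below_0[OF S] order_below_add[OF S])

lemma diffops_order_below:
  assumes "A \<in> diffops" shows "\<exists>m. order_below UNIV m A"
  using assms
proof induction
  case (mult a)
  then show ?case
    using order_below_mult[OF differential_subring_UNIV order_below_id[OF differential_subring_UNIV]]
    by blast
next
  case h_partial
  then show ?case
    using order_below_h_partial[OF differential_subring_UNIV order_below_id[OF differential_subring_UNIV]]
    by auto
next
  case (add A B)
  then obtain m m' where "order_below UNIV m A" "order_below UNIV m' B" by blast
  then have "order_below UNIV (max m m') A" "order_below UNIV (max m m') B"
    using order_below_mono[OF differential_subring_UNIV] by (auto intro: max.cobounded1)
  then show ?case using order_below_add[OF differential_subring_UNIV] by blast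
next
  case (comp A B)
  then obtain m m' where A: "order_below UNIV m A" and B: "order_below UNIV m' B" by blast
  obtain a where a: "\<And>f. A f = (\<Sum>i<m. a i * (h_partial ^^ i) f)"
    using A by (auto simp: order_below_def)
  have "order_below UNIV (m' + m) (\<lambda>f. \<Sum>i<m. a i * (h_partial ^^ i) (B f))"
    by (intro order_below_sum order_below_mult differential_subring_UNIV UNIV_I
        order_below_mono[OF _ order_below_h_partial_power[OF _ B]]) auto
  then show ?case by (auto simp: a o_def)
qed

text \<open>Faithfulness of the action on \<open>\<complex>(h)[q]\<close> lets leading terms be compared: an operator with a
  nonzero coefficient at \<open>(h_partial ^^ m)\<close> cannot be rewritten with lower powers only.\<close>

lemma leading_coefficient_0:
  assumes "order_below UNIV m B" "order_below UNIV m C"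
    and eq: "\<And>f. a * (h_partial ^^ m) f + B f = C f"
  shows "a = 0"
proof -
  obtain b c where b: "\<And>f. B f = (\<Sum>i<m. b i * (h_partial ^^ i) f)"
    and c: "\<And>f. C f = (\<Sum>i<m. c i * (h_partial ^^ i) f)"
    using assms by (auto simp: order_below_def)
  have "(\<Sum>i<Suc m. (if i < m then b i - c i else a) * (h_partial ^^ i) f) = 0" for f
    using eq[of f] by (simp add: b c algebra_simps sum_subtractf)
  from operators_faithful[OF this, of m] show ?thesis by simp
qed

lemma coefficients_unique:
  assumes "\<And>f. (\<Sum>i<m. a i * (h_partial ^^ i) f) = (\<Sum>i<m. b i * (h_partial ^^ i) f)" "i < m"
  shows "a i = b i"
proof -
  have "(\<Sum>i<m. (a i - b i) * (h_partial ^^ i) f) = 0" for f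
    using assms(1)[of f] by (simp add: algebra_simps sum_subtractf)
  from operators_faithful[OF this \<open>i < m\<close>] show ?thesis by simp
qed

lemma h_partial_power_add: "(h_partial ^^ i) (f + g) = (h_partial ^^ i) f + (h_partial ^^ i) g"
  by (induction i) (auto simp: h_partial_add)

text \<open>Division with remainder by a monic operator has a unique remainder. If \<open>a\<close> is the leading
  coefficient of \<open>A\<close>, of order \<open>m\<close>, then \<open>a\<close> is also the leading coefficient of \<open>A \<circ> P\<close>, now in order
  \<open>n + m\<close>; an element of the left ideal whose order is below \<open>n\<close> therefore forces \<open>a = 0\<close>, and
  one descends on \<open>m\<close>.\<close>

lemma left_ideal_order_below_0:
  assumes P: "\<And>f. P f = (h_partial ^^ n) f + B f" and B: "order_below UNIV n B"
    and "Q \<in> left_ideal P" and Q: "order_below UNIV n Q"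
  shows "Q f = 0"
proof -
  note U = differential_subring_UNIV
  obtain A where A: "A \<in> diffops" "Q = A \<circ> P"
    using assms(3) by (auto simp: left_ideal_def)
  obtain m where "order_below UNIV m A"
    using diffops_order_below[OF A(1)] by blast
  then obtain a where a: "\<And>f. A f = (\<Sum>i<m. a i * (h_partial ^^ i) f)"
    by (auto simp: order_below_def)
  have "(\<forall>f. A f = (\<Sum>i<m. a i * (h_partial ^^ i) f)) \<Longrightarrow> Q f = 0" for m
  proof (induction m)
    case 0
    then show ?case using A(2) by simp
  next
    case (Suc m)
    have lower: "order_below UNIV (n + m) (\<lambda>f. (\<Sum>i<m. a i * ((h_partial ^^ (n + i)) f + (h_partial ^^ i) (B f)))
        + a m * (h_partial ^^ m) (B f))"
    proof (intro order_below_add order_below_sum order_below_mult U UNIV_I)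
      fix i assume "i < m"
      then show "order_below UNIV (n + m) (h_partial ^^ (n + i))"
        using order_below_mono[OF U order_below_h_partial_power[OF U order_below_id[OF U]], of "n + i" "n + m"]
        by simp
      show "order_below UNIV (n + m) (\<lambda>f. (h_partial ^^ i) (B f))"
        using \<open>i < m\<close>
        by (intro order_below_mono[OF U order_below_h_partial_power[OF U B]]) auto
    next
      show "order_below UNIV (n + m) (\<lambda>f. (h_partial ^^ m) (B f))"
        by (rule order_below_h_partial_power[OF U B])
    qed
    have "a m = 0"
    proof (rule leading_coefficient_0[OF lower order_below_mono[OF U Q]])
      fix f
      have "Q f = (\<Sum>i<Suc m. a i * (h_partial ^^ i) (P f))"
        using Suc.prems A(2) by simp
      also have "\<dots> = (\<Sum>i<Suc m. a i * ((h_partial ^^ (n + i)) f + (h_partial ^^ i) (B f)))"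
        by (simp add: P h_partial_power_add funpow_add add.commute[of n])
      finally show "a m * (h_partial ^^ (n + m)) f +
          ((\<Sum>i<m. a i * ((h_partial ^^ (n + i)) f + (h_partial ^^ i) (B f)))
            + a m * (h_partial ^^ m) (B f)) = Q f"
        by (simp add: algebra_simps)
    qed auto
    with Suc show ?case by simp
  qed
  then show ?thesis using a by blast
qed

text \<open>The operator is monic of order \<open>N - 1\<close> with polynomial lower coefficients: the factor \<open>h ^ (k - 1)\<close>
  commutes with \<open>h_partial\<close> and can be distributed over the \<open>k - 1\<close> first order factors, each of
  which becomes \<open>k * h_partial + j * h\<close>. Their product has order \<open>k - 1 < N - 1\<close>.\<close>

lemma P_op_normal_form:
  assumes "1 \<le> k" "k < N"
  obtains c :: "nat \<Rightarrow> qh_poly" where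
    "\<And>f. P_op N k f = (h_partial ^^ (N - 1)) f - (\<Sum>i<N - 1. coef (c i) * (h_partial ^^ i) f)"
proof -
  note S = differential_subring_coef
  define factors where "factors js = foldr (\<circ>) (map (\<lambda>j f. of_nat k * partial_t f + of_nat j * f) js) id"
    for js :: "nat list"
  have factors: "order_below (range coef) (Suc (length js)) (\<lambda>f. coef (h_var ^ length js) * factors js f)" for js
  proof (induction js)
    case Nil
    then show ?case using order_below_id[OF S] by (simp add: factors_def coef_1)
  next
    case (Cons j js)
    let ?A = "\<lambda>f. coef (h_var ^ length js) * factors js f"
    have "coef (h_var ^ length (j # js)) * factors (j # js) f =
        coef (of_nat k) * h_partial (?A f) + coef (of_nat j * h_var) * ?A f" for f
    proof -
      have "pderiv (h_var ^ l) = 0" for l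
        by (induction l) (simp_all add: pderiv_mult pderiv_pCons pderiv_smult)
      then have "h_partial (coef (h_var ^ length js)) = 0"
        unfolding h_partial_coef by (simp only: mult_zero_right coef_0)
      then have "h_partial (?A f) = coef (h_var ^ length js) * h_partial (factors js f)"
        by (simp add: h_partial_mult)
      then have "h_partial (?A f) = coef (h_var ^ length js) * (coef h_var * partial_t (factors js f))"
        by (simp only: h_partial_def)
      moreover have "factors (j # js) f = of_nat k * partial_t (factors js f) + of_nat j * factors js f"
        by (simp add: factors_def)
      ultimately show ?thesis
        by (simp only: list.size add_0_right add_Suc_right power_Suc coef_mult coef_of_nat
            distrib_left mult_ac)
    qed
    moreover have "order_below (range coef) (Suc (length (j # js)))
        (\<lambda>f. coef (of_nat k) * h_partial (?A f) + coef (of_nat j * h_var) * ?A f)"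
      using order_below_add[OF S order_below_mult[OF S order_below_h_partial[OF S Cons]]
        order_below_mult[OF S order_below_mono[OF S Cons]]] by simp
    ultimately show ?case by simp
  qed
  have "order_below (range coef) (N - 1)
      (\<lambda>f. coef (of_nat k * q_var) * (coef (h_var ^ (k - 1)) * factors (rev [1..<k]) f))"
  proof (rule order_below_mult[OF S order_below_mono[OF S]])
    show "order_below (range coef) k (\<lambda>f. coef (h_var ^ (k - 1)) * factors (rev [1..<k]) f)"
      using factors[of "rev [1..<k]"] assms by simp
  qed (use assms in auto)
  then obtain c where c: "\<And>i. c i \<in> range coef"
    "\<And>f. coef (of_nat k * q_var) * (coef (h_var ^ (k - 1)) * factors (rev [1..<k]) f)
      = (\<Sum>i<N - 1. c i * (h_partial ^^ i) f)"
    by (rule order_belowE) (rule that)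
  have "\<forall>i. \<exists>r. c i = coef r" using c(1) by (auto simp: image_iff)
  from choice[OF this] obtain c' where c': "\<And>i. c i = coef (c' i)" by (elim exE) (rule that, elim allE)
  have "P_op N k f = (h_partial ^^ (N - 1)) f - (\<Sum>i<N - 1. coef (c' i) * (h_partial ^^ i) f)" for f
    unfolding P_op_def c'[symmetric] c(2)[symmetric] coef_mult factors_def by (simp only: mult.assoc)
  then show ?thesis by (rule that)
qed

section \<open>The Picard-Fuchs matrix\<close>

lemma diffops_uminus: "A \<in> diffops \<Longrightarrow> (\<lambda>f. - A f) \<in> diffops"
  using diffops.comp[OF diffops.mult[of "- 1"], of A] by (simp add: o_def)

lemma left_ideal_add: "A \<in> left_ideal P \<Longrightarrow> B \<in> left_ideal P \<Longrightarrow> (\<lambda>f. A f + B f) \<in> left_ideal P"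
  unfolding left_ideal_def using diffops.add by (fastforce simp: o_def)

lemma left_ideal_uminus: "A \<in> left_ideal P \<Longrightarrow> (\<lambda>f. - A f) \<in> left_ideal P"
  unfolding left_ideal_def using diffops_uminus by (fastforce simp: o_def)

lemma left_ideal_diff: "A \<in> left_ideal P \<Longrightarrow> B \<in> left_ideal P \<Longrightarrow> (\<lambda>f. A f - B f) \<in> left_ideal P"
  using left_ideal_add[OF _ left_ideal_uminus[of B P], of A] by simp

lemma left_ideal_0: "(\<lambda>f. 0) \<in> left_ideal P"
  unfolding left_ideal_def using diffops.mult[of 0] by (auto simp: fun_eq_iff intro!: exI[of _ "\<lambda>f. 0 * f"])

lemma op_class_eqI:
  assumes "(\<lambda>f. A f - B f) \<in> left_ideal P"
  shows "op_class P A = op_class P B"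
proof -
  have "(\<lambda>f. C f - A f) \<in> left_ideal P \<longleftrightarrow> (\<lambda>f. C f - B f) \<in> left_ideal P" for C
    using left_ideal_add[OF _ assms, of "\<lambda>f. C f - A f"] left_ideal_diff[OF _ assms, of "\<lambda>f. C f - B f"]
    by (auto simp: algebra_simps)
  then show ?thesis by (simp add: op_class_def)
qed

lemma op_class_eqD:
  assumes "op_class P A = op_class P B" "A \<in> diffops"
  shows "(\<lambda>f. A f - B f) \<in> left_ideal P"
proof -
  have "A \<in> op_class P A" using assms(2) left_ideal_0 by (simp add: op_class_def)
  then have "A \<in> op_class P B" by (simp only: assms(1))
  then show ?thesis by (simp add: op_class_def)
qed

lemma h_partial_power_diffops: "h_partial ^^ i \<in> diffops"
proof (induction i)
  case 0
  show ?case using diffops.mult[of 1] unfolding funpow_0 mult_1_left funpow.simps id_def .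
next
  case (Suc i)
  then show ?case unfolding funpow.simps by (intro diffops.comp diffops.h_partial)
qed

text \<open>The defining property of the Picard-Fuchs matrix has a solution, the companion matrix of the
  operator, because the last power \<open>h_partial ^^ (N - 1)\<close> is congruent to its lower terms. It has
  only one solution, because the difference of two candidate columns lies in the left ideal and has
  order below \<open>N - 1\<close>.\<close>

lemma PF_matrix_companion:
  assumes "1 \<le> k" "k < N"
    and P: "\<And>f. P_op N k f = (h_partial ^^ (N - 1)) f - (\<Sum>i<N - 1. coef (c i) * (h_partial ^^ i) f)"
  shows "PF_matrix N k = Matrix.mat (N - 1) (N - 1)
    (\<lambda>(i, j). if Suc j < N - 1 then (if i = Suc j then 1 else 0) else c i)"
proof -
  define n where "n = N - 1"
  define M where "M = Matrix.mat n n (\<lambda>(i, j). if Suc j < n then (if i = Suc j then 1 else 0) else c i)"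
  define column where "column R j f = (\<Sum>i<n. coef (R $$ (i, j)) * (h_partial ^^ i) f)"
    for R :: "qh_poly mat" and j f
  have PF: "is_PF_matrix N k R \<longleftrightarrow> R \<in> carrier_mat n n \<and>
      (\<forall>j<n. op_class (P_op N k) (h_partial ^^ Suc j) = op_class (P_op N k) (column R j))" for R
    by (simp add: is_PF_matrix_def n_def column_def[abs_def])
  have "is_PF_matrix N k M"
    unfolding PF
  proof (intro conjI allI impI op_class_eqI)
    fix j assume j: "j < n"
    show "(\<lambda>f. (h_partial ^^ Suc j) f - column M j f) \<in> left_ideal (P_op N k)"
    proof (cases "Suc j < n")
      case True
      have "column M j f = (\<Sum>i<n. if i = Suc j then (h_partial ^^ i) f else 0)" for f
        unfolding column_def using True j by (intro sum.cong) (auto simp: M_def coef_0 coef_1)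
      then show ?thesis using True by (simp add: left_ideal_0)
    next
      case False
      then have j': "Suc j = n" using j by simp
      have "(\<lambda>f. (h_partial ^^ Suc j) f - column M j f) = id \<circ> P_op N k"
        unfolding j' using False j by (auto simp: fun_eq_iff P n_def[symmetric] column_def M_def simp flip: One_nat_def)
      moreover have "id \<in> diffops" using h_partial_power_diffops[of 0] by simp
      ultimately show ?thesis unfolding left_ideal_def by blast
    qed
  qed (simp add: M_def)
  moreover have "R = M" if R: "is_PF_matrix N k R" for R
  proof (rule eq_matI)
    show "dim_row R = dim_row M" "dim_col R = dim_col M"
      using R by (auto simp: PF M_def)
    fix i j assume "i < dim_row M" "j < dim_col M"
    then have i: "i < n" and j: "j < n" by (simp_all add: M_def)
    have "(\<lambda>f. (h_partial ^^ Suc j) f - column S j f) \<in> left_ideal (P_op N k)"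
      if "is_PF_matrix N k S" for S
      using that j unfolding PF by (intro op_class_eqD h_partial_power_diffops) blast
    from left_ideal_diff[OF this[OF \<open>is_PF_matrix N k M\<close>] this[OF R]]
    have diff: "(\<lambda>f. column R j f - column M j f) \<in> left_ideal (P_op N k)"
      by simp
    have below: "order_below UNIV n (\<lambda>f. \<Sum>i<n. coef (a i) * (h_partial ^^ i) f)" for a
      unfolding order_below_def by auto
    have "column R j f - column M j f = 0" for f
    proof (rule left_ideal_order_below_0[OF _ _ diff])
      show "P_op N k f = (h_partial ^^ n) f + (\<Sum>i<n. coef (- c i) * (h_partial ^^ i) f)" for f
        by (simp add: P n_def coef_minus sum_negf)
      show "order_below UNIV n (\<lambda>f. column R j f - column M j f)"
        using below[of "\<lambda>i. R $$ (i, j) - M $$ (i, j)"]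
        by (simp add: column_def coef_diff left_diff_distrib sum_subtractf)
    qed (rule below)
    then have "(\<Sum>i<n. coef (R $$ (i, j)) * (h_partial ^^ i) f) = (\<Sum>i<n. coef (M $$ (i, j)) * (h_partial ^^ i) f)" for f
      by (simp add: column_def)
    from coefficients_unique[OF this i] show "R $$ (i, j) = M $$ (i, j)"
      by (simp add: coef_eq_iff)
  qed
  ultimately have "PF_matrix N k = M"
    unfolding PF_matrix_def by (rule the_equality)
  then show ?thesis
    by (simp only: M_def n_def)
qed

section \<open>The change of basis given by the reduction procedure\<close>

text \<open>Column \<open>\<beta>\<close> of the change of basis from the powers of \<open>h_partial\<close> to the operators \<open>reduced_seq R \<beta>\<close>.
  In the recursion, \<open>h_partial \<circ> p\<close> for a coefficient \<open>p\<close> contributes a shift by one power and, from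
  the Leibniz rule, the term \<open>h q dp/dq\<close>.\<close>

fun reduced_coeff :: "qh_poly mat \<Rightarrow> nat \<Rightarrow> nat \<Rightarrow> qh_poly" where
  "reduced_coeff R 0 i = (if i = 0 then 1 else 0)"
| "reduced_coeff R (Suc \<beta>) i =
     (case i of 0 \<Rightarrow> 0 | Suc i' \<Rightarrow> reduced_coeff R \<beta> i') +
     h_var * q_var * pderiv (reduced_coeff R \<beta> i) -
     (\<Sum>\<alpha>\<le>\<beta>. R $$ (\<alpha>, \<beta>) * reduced_coeff R \<alpha> i)"

declare reduced_coeff.simps(2) [simp del]

lemma reduced_coeff_upper: "\<beta> < i \<Longrightarrow> reduced_coeff R \<beta> i = 0"
proof (induction \<beta> arbitrary: i rule: less_induct)
  case (less \<beta>)
  show ?case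
  proof (cases \<beta>)
    case (Suc \<beta>')
    then show ?thesis
      using less by (auto simp: reduced_coeff.simps(2) split: nat.split intro!: sum.neutral)
  qed (use less.prems in simp)
qed

lemma reduced_coeff_diag: "reduced_coeff R \<beta> \<beta> = 1"
  by (induction \<beta>) (auto simp: reduced_coeff.simps(2) reduced_coeff_upper)

text \<open>At \<open>q = 0\<close> the diagonal and the upper part of \<open>R\<close> disappear and the recursion only shifts.\<close>

lemma reduced_coeff_q0:
  assumes R0: "\<And>\<alpha> \<beta>. \<alpha> \<le> \<beta> \<Longrightarrow> \<beta> < n \<Longrightarrow> poly (R $$ (\<alpha>, \<beta>)) 0 = 0"
  shows "\<beta> \<le> n \<Longrightarrow> poly (reduced_coeff R \<beta> i) 0 = (if i = \<beta> then 1 else 0)"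
proof (induction \<beta> arbitrary: i)
  case (Suc \<beta>)
  have "poly (\<Sum>\<alpha>\<le>\<beta>. R $$ (\<alpha>, \<beta>) * reduced_coeff R \<alpha> i) 0 = 0"
    using R0 Suc.prems by (simp add: poly_sum)
  then show ?case
    using Suc by (auto simp: reduced_coeff.simps(2) split: nat.split)
qed simp

lemma reduced_seq_eq_sum:
  "\<beta> < m \<Longrightarrow> reduced_seq R \<beta> f = (\<Sum>i<m. coef (reduced_coeff R \<beta> i) * (h_partial ^^ i) f)"
proof (induction \<beta> rule: less_induct)
  case (less \<beta>)
  show ?case
  proof (cases \<beta>)
    case 0
    have "(\<Sum>i<m. coef (reduced_coeff R \<beta> i) * (h_partial ^^ i) f) = (\<Sum>i<m. if i = 0 then f else 0)"
      using 0 by (intro sum.cong) (auto simp: coef_0 coef_1)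
    then show ?thesis using 0 less.prems by simp
  next
    case (Suc \<gamma>)
    have "(\<Sum>i<m. coef (reduced_coeff R \<gamma> i) * (h_partial ^^ Suc i) f) =
        (\<Sum>i<m. coef (case i of 0 \<Rightarrow> 0 | Suc i \<Rightarrow> reduced_coeff R \<gamma> i) * (h_partial ^^ i) f)"
    proof -
      obtain m' where m': "m = Suc m'" "\<gamma> < m'" using less.prems Suc by (cases m) auto
      show ?thesis
        unfolding m'(1)
        by (subst (2) sum.lessThan_Suc_shift) (simp add: coef_0 reduced_coeff_upper[OF m'(2)])
    qed
    moreover have "reduced_seq R \<gamma> f = (\<Sum>i<m. coef (reduced_coeff R \<gamma> i) * (h_partial ^^ i) f)"
      using less Suc by simp
    then have "h_partial (reduced_seq R \<gamma> f) =
        (\<Sum>i<m. coef (h_var * q_var * pderiv (reduced_coeff R \<gamma> i)) * (h_partial ^^ i) f) +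
        (\<Sum>i<m. coef (reduced_coeff R \<gamma> i) * (h_partial ^^ Suc i) f)"
      by (simp add: h_partial_sum h_partial_mult h_partial_coef sum.distrib del: mult_pCons_left)
    moreover have "(\<Sum>\<alpha>\<le>\<gamma>. coef (R $$ (\<alpha>, \<gamma>)) * reduced_seq R \<alpha> f) =
        (\<Sum>i<m. coef (\<Sum>\<alpha>\<le>\<gamma>. R $$ (\<alpha>, \<gamma>) * reduced_coeff R \<alpha> i) * (h_partial ^^ i) f)"
    proof -
      have "(\<Sum>\<alpha>\<le>\<gamma>. coef (R $$ (\<alpha>, \<gamma>)) * reduced_seq R \<alpha> f) =
        (\<Sum>\<alpha>\<le>\<gamma>. \<Sum>i<m. coef (R $$ (\<alpha>, \<gamma>)) * (coef (reduced_coeff R \<alpha> i) * (h_partial ^^ i) f))"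
        using less Suc by (intro sum.cong refl) (simp add: sum_distrib_left)
      also have "\<dots> = (\<Sum>i<m. \<Sum>\<alpha>\<le>\<gamma>. coef (R $$ (\<alpha>, \<gamma>)) * (coef (reduced_coeff R \<alpha> i) * (h_partial ^^ i) f))"
        by (rule sum.swap)
      finally show ?thesis by (simp add: coef_sum coef_mult sum_distrib_right mult.assoc)
    qed
    ultimately show ?thesis
      unfolding Suc reduced_seq.simps reduced_coeff.simps(2)
      by (simp only: coef_diff coef_add left_diff_distrib distrib_right sum.distrib sum_subtractf add_ac)
  qed
qed

text \<open>The change of basis is a gauge transformation from the Picard-Fuchs form to \<open>(1/h) R dt\<close>. Both
  sides express \<open>h_partial\<close> applied to the class of \<open>reduced_seq R \<beta>\<close> in the basis of powers. For
  \<open>\<beta> < N - 2\<close> this is the recursion of \<open>reduced_coeff\<close>; for the last column the next operator of the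
  sequence is \<open>P_op N k\<close> itself, so its coefficients are minus the last column of the companion
  matrix, and it drops out of the quotient.\<close>

lemma reduced_coeff_intertwines:
  assumes "1 \<le> k" "k < N" and reduced: "reduced_operator N R = P_op N k"
    and hess: "\<And>\<alpha> \<beta>. Suc \<beta> < \<alpha> \<Longrightarrow> \<alpha> < N - 1 \<Longrightarrow> R $$ (\<alpha>, \<beta>) = 0"
    and sub: "\<And>\<beta>. Suc \<beta> < N - 1 \<Longrightarrow> R $$ (Suc \<beta>, \<beta>) = 1"
    and i: "i < N - 1" and \<beta>: "\<beta> < N - 1"
  shows "(\<Sum>l<N - 1. PF_matrix N k $$ (i, l) * reduced_coeff R \<beta> l)
      + h_var * q_var * pderiv (reduced_coeff R \<beta> i)
    = (\<Sum>\<alpha><N - 1. reduced_coeff R \<alpha> i * R $$ (\<alpha>, \<beta>))"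
proof -
  define n where "n = N - 1"
  let ?T = "reduced_coeff R"
  obtain c where P: "\<And>f. P_op N k f = (h_partial ^^ n) f - (\<Sum>i<n. coef (c i) * (h_partial ^^ i) f)"
    using P_op_normal_form[OF assms(1,2)] unfolding n_def by blast
  have PF: "PF_matrix N k $$ (i, l) = (if Suc l < n then (if i = Suc l then 1 else 0) else c i)"
    if "l < n" for l
    using PF_matrix_companion[OF assms(1,2) P[unfolded n_def]] that i by (simp add: n_def)
  have top: "?T n i = - c i"
  proof -
    have "(\<Sum>i<n. coef (?T n i) * (h_partial ^^ i) f) = (\<Sum>i<n. coef (- c i) * (h_partial ^^ i) f)" for f
    proof -
      have "P_op N k f = (\<Sum>i<Suc n. coef (?T n i) * (h_partial ^^ i) f)"
        unfolding reduced[symmetric] reduced_operator_def n_def[symmetric]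
        by (rule reduced_seq_eq_sum) simp
      then show ?thesis by (simp add: P reduced_coeff_diag coef_1 coef_minus sum_negf)
    qed
    from coefficients_unique[OF this] i show ?thesis by (simp add: coef_eq_iff n_def)
  qed
  have shift: "(case i of 0 \<Rightarrow> 0 | Suc i \<Rightarrow> ?T \<beta> i) + h_var * q_var * pderiv (?T \<beta> i)
      = ?T (Suc \<beta>) i + (\<Sum>\<alpha>\<le>\<beta>. ?T \<alpha> i * R $$ (\<alpha>, \<beta>))"
    unfolding reduced_coeff.simps(2) by (simp add: mult.commute del: mult_pCons_left mult_pCons_right)
  obtain n' where n': "n = Suc n'" using \<beta> by (cases n) (auto simp: n_def)
  have "(\<Sum>l<n. PF_matrix N k $$ (i, l) * ?T \<beta> l) =
      (\<Sum>l<n'. (if i = Suc l then ?T \<beta> l else 0)) + c i * ?T \<beta> n'"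
    using PF n' by (auto intro!: sum.cong)
  also have "(\<Sum>l<n'. (if i = Suc l then ?T \<beta> l else 0)) = (case i of 0 \<Rightarrow> 0 | Suc i \<Rightarrow> ?T \<beta> i)"
    using i n' by (auto simp: n_def[symmetric] simp flip: One_nat_def split: nat.split)
  finally have PFT: "(\<Sum>l<n. PF_matrix N k $$ (i, l) * ?T \<beta> l) =
      (case i of 0 \<Rightarrow> 0 | Suc i \<Rightarrow> ?T \<beta> i) + c i * ?T \<beta> n'" .
  show ?thesis
  proof (cases "Suc \<beta> < n")
    case True
    have "(\<Sum>\<alpha><n. ?T \<alpha> i * R $$ (\<alpha>, \<beta>)) = (\<Sum>\<alpha>\<in>{..Suc \<beta>}. ?T \<alpha> i * R $$ (\<alpha>, \<beta>))"
      using True hess by (intro sum.mono_neutral_right) (auto simp: n_def)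
    also have "\<dots> = (\<Sum>\<alpha>\<le>\<beta>. ?T \<alpha> i * R $$ (\<alpha>, \<beta>)) + ?T (Suc \<beta>) i"
      using sub[of \<beta>] True by (simp add: n_def)
    finally show ?thesis
      using PFT shift reduced_coeff_upper[of \<beta> n' R] True n'
      by (simp add: n_def[symmetric] del: mult_pCons_left mult_pCons_right flip: One_nat_def)
  next
    case False
    then have \<beta>': "\<beta> = n'" "Suc \<beta> = n" using \<beta> n' by (auto simp: n_def)
    then have "{..<n} = {..\<beta>}" by auto
    then show ?thesis
      using PFT shift top \<beta>'
      by (simp add: n_def[symmetric] reduced_coeff_diag eq_diff_eq add_ac
          del: mult_pCons_left mult_pCons_right flip: One_nat_def)
  qed
qed

section \<open>Comparison at infinity\<close>

text \<open>The difference of the two functions, read in the coordinate \<open>1/h\<close>, is holomorphic in the unit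
  disc, including the centre by removal of the singularity, and vanishes on the boundary circle.\<close>

lemma limit_at_infinity_determined_by_sphere:
  fixes f g :: "complex \<Rightarrow> complex"
  assumes f: "continuous_on {h. 1 \<le> norm h} f" "f holomorphic_on {h. 1 < norm h}" "(f \<longlongrightarrow> a) at_infinity"
    and g: "continuous_on {h. 1 \<le> norm h} g" "g holomorphic_on {h. 1 < norm h}" "(g \<longlongrightarrow> b) at_infinity"
    and eq: "\<And>h. norm h = 1 \<Longrightarrow> f h = g h"
  shows "a = b"
proof -
  define w where "w z = (if z = 0 then a - b else f (inverse z) - g (inverse z))" for z
  have lim: "(w \<longlongrightarrow> w 0) (at 0)"
  proof -
    have "((\<lambda>h. f h - g h) \<longlongrightarrow> a - b) at_infinity"
      by (intro tendsto_diff f g)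
    then have "((\<lambda>z. f (inverse z) - g (inverse z)) \<longlongrightarrow> a - b) (at 0)"
      by (simp add: lim_at_infinity_0 o_def)
    then have "(w \<longlongrightarrow> a - b) (at 0)"
      by (rule Lim_transform_eventually) (auto simp: w_def eventually_at_filter)
    then show ?thesis by (simp add: w_def)
  qed
  have inv_image: "inverse ` (cball 0 1 - {0}) \<subseteq> {h :: complex. 1 \<le> norm h}"
    "inverse ` (ball 0 1 - {0}) \<subseteq> {h :: complex. 1 < norm h}"
    by (auto simp: norm_inverse one_le_inverse one_less_inverse)
  have "continuous_on (cball 0 1 - {0}) (\<lambda>z. f (inverse z) - g (inverse z))"
    using inv_image(1) by (intro continuous_intros continuous_on_compose2[OF f(1)] continuous_on_compose2[OF g(1)]) auto
  then have "continuous_on (cball 0 1 - {0}) w"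
    by (rule continuous_on_eq) (simp add: w_def)
  then have cont: "continuous_on (cball 0 1) w"
    unfolding continuous_on_def
  proof (intro ballI)
    fix x :: complex assume x: "x \<in> cball 0 1"
    show "(w \<longlongrightarrow> w x) (at x within cball 0 1)"
    proof (cases "x = 0")
      case False
      then have "at x within cball 0 1 = at x within (cball 0 1 - {0})"
        by (intro at_within_nhd[of x "- {0}"]) auto
      then show ?thesis
        using \<open>continuous_on (cball 0 1 - {0}) w\<close> x False by (auto simp: continuous_on_def)
    qed (use lim in \<open>auto intro: tendsto_within_subset\<close>)
  qed
  have "(\<lambda>z. f (inverse z) - g (inverse z)) holomorphic_on (ball 0 1 - {0})"
    using inv_image(2)
    by (intro holomorphic_intros holomorphic_on_compose_gen[OF _ f(2), unfolded o_def]
        holomorphic_on_compose_gen[OF _ g(2), unfolded o_def]) auto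
  then have "w holomorphic_on (ball 0 1 - {0})"
    by (rule holomorphic_transform) (auto simp: w_def)
  then have hol: "w holomorphic_on ball 0 1"
    by (rule no_isolated_singularity[where K = "{0}", rotated])
       (auto intro: continuous_on_subset[OF cont])
  have "norm (w 0) \<le> 0"
  proof (rule maximum_modulus_frontier[of w "ball 0 1"])
    show "norm (w z) \<le> 0" if "z \<in> frontier (ball 0 1)" for z
      using that eq[of "inverse z"] by (auto simp: w_def frontier_ball norm_inverse)
  qed (use hol cont in auto)
  then show ?thesis by (simp add: w_def)
qed

lemma poly_over_power_tendsto_coeff:
  fixes p :: "complex poly"
  assumes "degree p \<le> d"
  shows "((\<lambda>h. poly p h / h ^ d) \<longlongrightarrow> coeff p d) at_infinity"
proof -
  have eq: "poly p h / h ^ d = (\<Sum>i\<le>d. coeff p i * inverse h ^ (d - i))" if "h \<noteq> 0" for h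
  proof -
    have "poly p h = (\<Sum>i\<le>d. coeff p i * h ^ i)"
      unfolding poly_altdef using assms by (intro sum.mono_neutral_left) (auto simp: coeff_eq_0)
    moreover have "h ^ i / h ^ d = inverse h ^ (d - i)" if "i \<le> d" for i
      using \<open>h \<noteq> 0\<close> that by (simp add: power_diff field_simps)
    ultimately show ?thesis
      by (simp add: sum_divide_distrib flip: times_divide_eq_right)
  qed
  have "((\<lambda>h. \<Sum>i\<le>d. coeff p i * inverse h ^ (d - i)) \<longlongrightarrow> (\<Sum>i\<le>d. coeff p i * 0 ^ (d - i))) at_infinity"
    by (intro tendsto_intros tendsto_inverse_0)
  also have "(\<Sum>i\<le>d. coeff p i * 0 ^ (d - i)) = (\<Sum>i\<le>d. if i = d then coeff p d else 0)"
    by (intro sum.cong) (auto simp: power_0_left)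
  finally have "((\<lambda>h. \<Sum>i\<le>d. coeff p i * inverse h ^ (d - i)) \<longlongrightarrow> coeff p d) at_infinity"
    by simp
  moreover have "eventually (\<lambda>h. (\<Sum>i\<le>d. coeff p i * inverse h ^ (d - i)) = poly p h / h ^ d) at_infinity"
    unfolding eventually_at_infinity
  proof (intro exI[of _ 1] allI impI)
    fix h :: complex assume "1 \<le> norm h"
    then have "h \<noteq> 0" by auto
    from eq[OF this] show "(\<Sum>i\<le>d. coeff p i * inverse h ^ (d - i)) = poly p h / h ^ d" by (rule sym)
  qed
  ultimately show ?thesis
    by (rule Lim_transform_eventually)
qed

text \<open>If \<open>F P Z = G Q\<close> on the unit circle, where \<open>F\<close>, \<open>G\<close> and \<open>Z(1/h)\<close> extend to the outside of the circle
  with value the identity at infinity and \<open>P\<close>, \<open>Q\<close> are polynomial in \<open>h\<close>, then after division by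
  \<open>h ^ d\<close> both sides have a limit at infinity: the coefficient matrix of \<open>h ^ d\<close> in \<open>P\<close> and in \<open>Q\<close>.\<close>

lemma leading_coefficients_agree:
  fixes F G Z :: "nat \<Rightarrow> nat \<Rightarrow> complex \<Rightarrow> complex" and P Q :: "nat \<Rightarrow> nat \<Rightarrow> complex poly"
  assumes F: "\<And>i j. i < n \<Longrightarrow> j < n \<Longrightarrow> continuous_on {h. 1 \<le> norm h} (F i j)"
      "\<And>i j. i < n \<Longrightarrow> j < n \<Longrightarrow> F i j holomorphic_on {h. 1 < norm h}"
      "\<And>i j. i < n \<Longrightarrow> j < n \<Longrightarrow> (F i j \<longlongrightarrow> (if i = j then 1 else 0)) at_infinity"
    and G: "\<And>i j. i < n \<Longrightarrow> j < n \<Longrightarrow> continuous_on {h. 1 \<le> norm h} (G i j)"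
      "\<And>i j. i < n \<Longrightarrow> j < n \<Longrightarrow> G i j holomorphic_on {h. 1 < norm h}"
      "\<And>i j. i < n \<Longrightarrow> j < n \<Longrightarrow> (G i j \<longlongrightarrow> (if i = j then 1 else 0)) at_infinity"
    and Z: "\<And>i j. i < n \<Longrightarrow> j < n \<Longrightarrow> continuous_on (cball 0 1) (Z i j)"
      "\<And>i j. i < n \<Longrightarrow> j < n \<Longrightarrow> Z i j holomorphic_on ball 0 1"
      "\<And>i j. i < n \<Longrightarrow> j < n \<Longrightarrow> (Z i j \<longlongrightarrow> (if i = j then 1 else 0)) (at 0)"
    and deg: "\<And>i j. i < n \<Longrightarrow> j < n \<Longrightarrow> degree (P i j) \<le> d"
      "\<And>i j. i < n \<Longrightarrow> j < n \<Longrightarrow> degree (Q i j) \<le> d"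
    and ij: "i < n" "j < n"
    and eq: "\<And>h. norm h = 1 \<Longrightarrow>
      (\<Sum>k<n. F i k h * (\<Sum>l<n. poly (P k l) h * Z l j (inverse h))) = (\<Sum>k<n. G i k h * poly (Q k j) h)"
  shows "coeff (P i j) d = coeff (Q i j) d"
proof -
  define f where "f h = (\<Sum>k<n. F i k h * (\<Sum>l<n. poly (P k l) h / h ^ d * Z l j (inverse h)))" for h
  define g where "g h = (\<Sum>k<n. G i k h * (poly (Q k j) h / h ^ d))" for h
  have inv_image: "inverse ` {h :: complex. 1 \<le> norm h} \<subseteq> cball 0 1"
    "inverse ` {h :: complex. 1 < norm h} \<subseteq> ball 0 1"
    by (auto simp: norm_inverse inverse_le_1_iff inverse_less_1_iff)
  have nz: "h \<noteq> 0" if "1 \<le> norm h" for h :: complex using that by auto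
  have "continuous_on {h. 1 \<le> norm h} f"
    unfolding f_def using inv_image(1) nz ij
    by (intro continuous_intros F continuous_on_compose2[OF Z(1)]) auto
  moreover have "f holomorphic_on {h. 1 < norm h}"
    unfolding f_def using inv_image(2) ij
    by (intro holomorphic_intros F holomorphic_on_compose_gen[OF _ Z(2), unfolded o_def]) auto
  moreover have "(f \<longlongrightarrow> (\<Sum>k<n. (if i = k then 1 else 0) * (\<Sum>l<n. coeff (P k l) d * (if l = j then 1 else 0)))) at_infinity"
    unfolding f_def
  proof (intro tendsto_sum tendsto_mult F poly_over_power_tendsto_coeff deg)
    fix l assume "l \<in> {..<n}"
    then show "((\<lambda>h. Z l j (inverse h)) \<longlongrightarrow> (if l = j then 1 else 0)) at_infinity"
      using Z(3)[of l j] ij by (simp add: lim_at_infinity_0 o_def)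
  qed (use ij in auto)
  moreover have "continuous_on {h. 1 \<le> norm h} g"
    unfolding g_def using nz ij by (intro continuous_intros G) auto
  moreover have "g holomorphic_on {h. 1 < norm h}"
    unfolding g_def using ij by (intro holomorphic_intros G) auto
  moreover have "(g \<longlongrightarrow> (\<Sum>k<n. (if i = k then 1 else 0) * coeff (Q k j) d)) at_infinity"
    unfolding g_def using ij
    by (intro tendsto_sum tendsto_mult G poly_over_power_tendsto_coeff deg) auto
  moreover have "f h = g h" if "norm h = 1" for h
  proof -
    have "f h = (\<Sum>k<n. F i k h * (\<Sum>l<n. poly (P k l) h * Z l j (inverse h))) / h ^ d"
      unfolding f_def by (simp add: sum_divide_distrib sum_distrib_left)
    also have "\<dots> = g h"
      unfolding eq[OF that] g_def by (simp add: sum_divide_distrib)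
    finally show ?thesis .
  qed
  ultimately have "(\<Sum>k<n. (if i = k then 1 else 0) * (\<Sum>l<n. coeff (P k l) d * (if l = j then 1 else 0)))
      = (\<Sum>k<n. (if i = k then 1 else 0) * coeff (Q k j) d)"
    by (rule limit_at_infinity_determined_by_sphere)
  moreover have "(\<Sum>k<n. (if i = k then 1 else 0) * x k) = x i" for x :: "nat \<Rightarrow> complex"
    using ij by (simp add: if_distrib[of "\<lambda>c. c * _"] cong: if_cong)
  ultimately show ?thesis
    using ij by (simp add: if_distrib[of "\<lambda>c. _ * c"] cong: if_cong)
qed


section \<open>Flat frames for a connection linear in 1/h\<close>

text \<open>The equation \<open>dZ/dt = - z A Z\<close>, \<open>Z(t0) = 1\<close>, solved by Picard iteration as a power series in \<open>z\<close>. With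
  \<open>z = 1/h\<close> this is the dual of the equation \<open>dH = H (A/h) dt\<close>. Since \<open>A\<close> does not
  involve \<open>z\<close>, the solution is holomorphic in \<open>z\<close> beyond the closed unit disc and is the
  identity at \<open>z = 0\<close>.\<close>

lemma parallel_frame_near:
  fixes A :: "nat \<Rightarrow> nat \<Rightarrow> complex \<Rightarrow> complex"
  assumes A: "\<And>i j. A i j holomorphic_on UNIV" and V: "open V" "t0 \<in> V"
  obtains r and Z :: "nat \<Rightarrow> nat \<Rightarrow> complex \<Rightarrow> complex \<Rightarrow> complex"
  where "0 < r" "ball t0 r \<subseteq> V"
    "\<And>i j t. i < n \<Longrightarrow> t \<in> ball t0 r \<Longrightarrow> Z i j t holomorphic_on ball 0 (3/2)"
    "\<And>i j t. Z i j t 0 = (if i = j then 1 else 0)"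
    "\<And>i j z. Z i j t0 z = (if i = j then 1 else 0)"
    "\<And>i j t z. i < n \<Longrightarrow> t \<in> ball t0 r \<Longrightarrow> norm z \<le> 1 \<Longrightarrow>
       ((\<lambda>s. Z i j s z) has_field_derivative - (z * (\<Sum>k<n. A i k t * Z k j t z))) (at t)"
proof -
  define primitive where "primitive f = (SOME g. g t0 = 0 \<and> (\<forall>t. (g has_field_derivative f t) (at t)))"
    for f :: "complex \<Rightarrow> complex"
  have primitive: "primitive f t0 = 0" "(primitive f has_field_derivative f t) (at t)"
    if f: "f holomorphic_on UNIV" for f t
  proof -
    obtain g where g: "\<And>t. (g has_field_derivative f t) (at t)"
      using holomorphic_convex_primitive'[OF convex_UNIV open_UNIV f] by auto
    have "\<exists>g. g t0 = 0 \<and> (\<forall>t. (g has_field_derivative f t) (at t))"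
      by (intro exI[of _ "\<lambda>t. g t - g t0"]) (auto intro!: derivative_eq_intros g)
    from someI_ex[OF this] show "primitive f t0 = 0" "(primitive f has_field_derivative f t) (at t)"
      unfolding primitive_def by blast+
  qed
  \<comment> \<open>\<open>Y m\<close> is the coefficient of \<open>z ^ m\<close>; it solves \<open>dY m/dt = - A (Y (m - 1))\<close>.\<close>
  define Y where "Y = rec_nat (\<lambda>i j t. if i = j then 1 else 0)
      (\<lambda>_ Y i j. primitive (\<lambda>t. - (\<Sum>k<n. A i k t * Y k j t)))"
  have Y_0: "Y 0 i j t = (if i = j then 1 else 0)" for i j t by (simp add: Y_def)
  have Y_Suc: "Y (Suc m) i j = primitive (\<lambda>t. - (\<Sum>k<n. A i k t * Y m k j t))" for m i j
    by (simp add: Y_def)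
  have Y_hol: "Y m i j holomorphic_on UNIV" for m i j
  proof (induction m arbitrary: i j)
    case 0
    have "Y 0 i j = (\<lambda>t. if i = j then 1 else 0)" by (simp add: fun_eq_iff Y_0)
    then show ?case by simp
  next
    case (Suc m)
    have "(\<lambda>t. - (\<Sum>k<n. A i k t * Y m k j t)) holomorphic_on UNIV"
      by (intro holomorphic_intros A Suc)
    from primitive(2)[OF this] show ?case
      unfolding Y_Suc holomorphic_on_open[OF open_UNIV] by blast
  qed
  have hol: "(\<lambda>t. - (\<Sum>k<n. A i k t * Y m k j t)) holomorphic_on UNIV" for m i j
    by (intro holomorphic_intros A Y_hol)
  have Y_deriv: "(Y (Suc m) i j has_field_derivative - (\<Sum>k<n. A i k t * Y m k j t)) (at t)" for m i j t
    unfolding Y_Suc by (rule primitive(2)[OF hol])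
  have Y_t0: "Y (Suc m) i j t0 = 0" for m i j
    unfolding Y_Suc by (rule primitive(1)[OF hol])
  have "continuous_on (cball t0 1) (\<lambda>t. \<Sum>i<n. \<Sum>k<n. norm (A i k t))"
    by (intro continuous_intros holomorphic_on_imp_continuous_on holomorphic_on_subset[OF A]) auto
  then have "bounded ((\<lambda>t. \<Sum>i<n. \<Sum>k<n. norm (A i k t)) ` cball t0 1)"
    by (intro compact_imp_bounded compact_continuous_image) auto
  then obtain C where "0 < C" and C_sum: "\<And>t. t \<in> cball t0 1 \<Longrightarrow> norm (\<Sum>i<n. \<Sum>k<n. norm (A i k t)) \<le> C"
    unfolding bounded_pos by (auto simp: image_iff)
  have C: "(\<Sum>k<n. norm (A i k t)) \<le> C" if "i < n" "t \<in> cball t0 1" for i t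
  proof -
    have "(\<Sum>k<n. norm (A i k t)) \<le> (\<Sum>i<n. \<Sum>k<n. norm (A i k t))"
      using that by (intro member_le_sum) (auto intro: sum_nonneg)
    then show ?thesis using C_sum[OF that(2)] unfolding real_norm_def by linarith
  qed
  obtain r0 where r0: "0 < r0" "ball t0 r0 \<subseteq> V"
    using V openE by blast
  \<comment> \<open>On a ball with \<open>C * r \<le> 1/2\<close> each integration halves the bound, so the series converges for \<open>norm z < 2\<close>.\<close>
  define r where "r = min r0 (min 1 (1 / (2 * C)))"
  have r: "0 < r" "r \<le> r0" "r \<le> 1" "C * r \<le> 1 / 2"
    using r0 \<open>0 < C\<close> mult_left_mono[of r "1 / (2 * C)" C] by (auto simp: r_def)
  have sum_bound: "norm (- (\<Sum>k<n. A i k t * Y m k j t)) \<le> C * b"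
    if "\<And>k. k < n \<Longrightarrow> norm (Y m k j t) \<le> b" "i < n" "t \<in> ball t0 r" "0 \<le> b" for m i j t b
  proof -
    have "norm (- (\<Sum>k<n. A i k t * Y m k j t)) \<le> (\<Sum>k<n. norm (A i k t) * b)"
      unfolding norm_minus_cancel
      by (rule sum_norm_le) (use that in \<open>auto simp: norm_mult intro!: mult_left_mono\<close>)
    also have "\<dots> = (\<Sum>k<n. norm (A i k t)) * b" by (simp add: sum_distrib_right)
    also have "\<dots> \<le> C * b" using that r C[of i t] by (intro mult_right_mono) auto
    finally show ?thesis .
  qed
  have Y_bound: "norm (Y m i j t) \<le> (1 / 2) ^ m" if "i < n" "t \<in> ball t0 r" for m i j t
    using that
  proof (induction m arbitrary: i t)
    case (Suc m)
    have "norm (Y (Suc m) i j t - Y (Suc m) i j t0) \<le> (C * (1 / 2) ^ m) * norm (t - t0)"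
    proof (rule field_differentiable_bound[of "ball t0 r"])
      show "(Y (Suc m) i j has_field_derivative - (\<Sum>k<n. A i k s * Y m k j s)) (at s within ball t0 r)" for s
        by (rule has_field_derivative_at_within[OF Y_deriv])
      show "norm (- (\<Sum>k<n. A i k s * Y m k j s)) \<le> C * (1 / 2) ^ m" if "s \<in> ball t0 r" for s
        using that Suc by (intro sum_bound) auto
    qed (use Suc.prems r in auto)
    also have "\<dots> \<le> (C * (1 / 2) ^ m) * r"
      using Suc.prems \<open>0 < C\<close> by (intro mult_left_mono) (auto simp: dist_norm norm_minus_commute)
    also have "\<dots> = (C * r) * (1 / 2) ^ m" by simp
    also have "\<dots> \<le> (1 / 2) * (1 / 2) ^ m" using r by (intro mult_right_mono) auto
    finally show ?case by (simp add: Y_t0)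
  qed (simp add: Y_0)
  define Z where "Z i j t z = (\<Sum>m. Y m i j t * z ^ m)" for i j t z
  have summable: "summable (\<lambda>m. Y m i j t * z ^ m)" if "i < n" "t \<in> ball t0 r" "norm z < 3 / 2" for i j t z
  proof (rule summable_comparison_test'[of "\<lambda>m. (3 / 4) ^ m"])
    fix m
    have "norm (Y m i j t * z ^ m) \<le> (1 / 2) ^ m * (3 / 2) ^ m"
      unfolding norm_mult norm_power using that Y_bound[of i t m j]
      by (intro mult_mono power_mono) auto
    then show "norm (Y m i j t * z ^ m) \<le> (3 / 4) ^ m"
      by (simp flip: power_mult_distrib)
  qed simp
  have deriv: "((\<lambda>s. Z i j s z) has_field_derivative - (z * (\<Sum>k<n. A i k t * Z k j t z))) (at t)"
    if i: "i < n" and t: "t \<in> ball t0 r" and z: "norm z \<le> 1" for i j t z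
  proof -
    define Y' where "Y' m s = (case m of 0 \<Rightarrow> 0 | Suc m \<Rightarrow> - (\<Sum>k<n. A i k s * Y m k j s)) * z ^ m" for m s
    have "uniformly_convergent_on (ball t0 r) (\<lambda>n x. \<Sum>i<n. Y' i x)"
    proof (rule Weierstrass_m_test'[of _ _ "\<lambda>m. 2 * C * (1 / 2) ^ m"])
      fix m s assume s: "s \<in> ball t0 r"
      show "norm (Y' m s) \<le> 2 * C * (1 / 2) ^ m"
      proof (cases m)
        case (Suc m')
        have "norm (- (\<Sum>k<n. A i k s * Y m' k j s)) \<le> C * (1 / 2) ^ m'"
          using i s Y_bound by (intro sum_bound) auto
        moreover have "norm (z ^ m) \<le> 1" using z by (simp add: norm_power power_le_one)
        ultimately have "norm (- (\<Sum>k<n. A i k s * Y m' k j s)) * norm (z ^ m) \<le> (C * (1 / 2) ^ m') * 1"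
          using \<open>0 < C\<close> by (intro mult_mono) auto
        then show ?thesis by (simp add: Y'_def Suc norm_mult)
      qed (use \<open>0 < C\<close> in \<open>simp add: Y'_def\<close>)
    qed (intro summable_mult summable_geometric, simp)
    then have "((\<lambda>s. \<Sum>m. Y m i j s * z ^ m) has_field_derivative (\<Sum>m. Y' m t)) (at t)"
    proof (rule has_field_derivative_series'(2)[rotated 2])
      fix m s
      show "((\<lambda>s. Y m i j s * z ^ m) has_field_derivative Y' m s) (at s within ball t0 r)"
      proof (cases m)
        case 0
        have "Y 0 i j = (\<lambda>t. if i = j then 1 else 0)" by (simp add: fun_eq_iff Y_0)
        then show ?thesis using 0 by (simp add: Y'_def)
      next
        case (Suc m')
        then show ?thesis
          unfolding Y'_def
          by (auto intro!: derivative_eq_intros has_field_derivative_at_within[OF Y_deriv])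
      qed
    qed (use r i t z summable[of i t0 z j] in auto)
    moreover have "(\<Sum>m. Y' m t) = - (z * (\<Sum>k<n. A i k t * Z k j t z))"
    proof -
      have "(\<lambda>m. Y m k j t * z ^ m) sums Z k j t z" if "k < n" for k
        unfolding Z_def using summable[OF that t] z by (intro summable_sums) auto
      then have "(\<lambda>m. \<Sum>k<n. A i k t * (Y m k j t * z ^ m)) sums (\<Sum>k<n. A i k t * Z k j t z)"
        by (intro sums_sum sums_mult) auto
      then have "(\<lambda>m. - z * (\<Sum>k<n. A i k t * (Y m k j t * z ^ m))) sums (- z * (\<Sum>k<n. A i k t * Z k j t z))"
        by (rule sums_mult)
      moreover have "- z * (\<Sum>k<n. A i k t * (Y m k j t * z ^ m)) = Y' (Suc m) t" for m
        by (simp add: Y'_def sum_distrib_left sum_distrib_right sum_negf mult_ac)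
      ultimately have "(\<lambda>m. Y' (Suc m) t) sums (- z * (\<Sum>k<n. A i k t * Z k j t z))" by simp
      from sums_Suc[OF this] show ?thesis by (simp add: Y'_def sums_iff)
    qed
    ultimately show ?thesis unfolding Z_def by simp
  qed
  show ?thesis
  proof
    show "0 < r" by fact
    show "ball t0 r \<subseteq> V" using r0 r by auto
    show "Z i j t holomorphic_on ball 0 (3/2)" if "i < n" "t \<in> ball t0 r" for i j t
      unfolding Z_def
      by (rule power_series_holomorphic) (use summable[OF that] in \<open>auto intro: summable_sums\<close>)
    show "Z i j t 0 = (if i = j then 1 else 0)" for i j t
      unfolding Z_def by (simp add: Y_0)
    show "Z i j t0 z = (if i = j then 1 else 0)" for i j z
    proof -
      have "Y m i j t0 * z ^ m = 0" if "m \<notin> {0}" for m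
        using that by (cases m) (auto simp: Y_t0)
      then have "(\<lambda>m. Y m i j t0 * z ^ m) sums (\<Sum>m\<in>{0}. Y m i j t0 * z ^ m)"
        by (intro sums_finite) auto
      then show ?thesis by (simp add: Z_def sums_iff Y_0)
    qed
  qed (rule deriv)
qed

text \<open>The two terms of the product rule cancel, one equation being the dual of the other. A dual frame \<open>Z\<close>
  thus does the work of uniqueness of solutions and of inverses of fundamental matrices.\<close>

lemma parallel_pairing_constant:
  fixes H Z A :: "nat \<Rightarrow> complex \<Rightarrow> complex" and B :: "nat \<Rightarrow> nat \<Rightarrow> complex \<Rightarrow> complex"
  assumes "convex S" "open S" "s \<in> S" "t \<in> S"
    and H: "\<And>l t. l < n \<Longrightarrow> t \<in> S \<Longrightarrow> (H l has_field_derivative (\<Sum>m<n. H m t * B m l t)) (at t)"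
    and Z: "\<And>l t. l < n \<Longrightarrow> t \<in> S \<Longrightarrow> (Z l has_field_derivative - (\<Sum>m<n. B l m t * Z m t)) (at t)"
  shows "(\<Sum>l<n. H l t * Z l t) = (\<Sum>l<n. H l s * Z l s)"
proof -
  have "((\<lambda>t. \<Sum>l<n. H l t * Z l t) has_field_derivative 0) (at t within S)" if "t \<in> S" for t
  proof -
    have "((\<lambda>t. \<Sum>l<n. H l t * Z l t) has_field_derivative
        (\<Sum>l<n. (\<Sum>m<n. H m t * B m l t) * Z l t + - (\<Sum>m<n. B l m t * Z m t) * H l t)) (at t)"
      by (intro DERIV_sum DERIV_mult H Z) (use that in auto)
    also have "(\<Sum>l<n. (\<Sum>m<n. H m t * B m l t) * Z l t + - (\<Sum>m<n. B l m t * Z m t) * H l t) =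
        (\<Sum>l<n. \<Sum>m<n. H m t * B m l t * Z l t) - (\<Sum>l<n. \<Sum>m<n. H l t * B l m t * Z m t)"
      by (simp add: sum.distrib sum_distrib_left sum_distrib_right sum_negf sum_subtractf mult_ac)
    also have "(\<Sum>l<n. \<Sum>m<n. H l t * B l m t * Z m t) = (\<Sum>l<n. \<Sum>m<n. H m t * B m l t * Z l t)"
      by (rule sum.swap)
    finally show ?thesis by (simp add: has_field_derivative_at_within)
  qed
  then obtain c where "\<forall>t\<in>S. (\<Sum>l<n. H l t * Z l t) = c"
    using has_field_derivative_zero_constant[OF \<open>convex S\<close>] by blast
  then show ?thesis using assms(3,4) by simp
qed

section \<open>Uniqueness of the normalized gauge\<close>

text \<open>The image of a ball under \<open>exp\<close> is open, hence infinite, and a nonconstant polynomial takes each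
  value finitely often.\<close>

lemma poly_eq_const_if_constant_on_exp_ball:
  fixes p :: "complex poly"
  assumes "0 < r" and const: "\<And>t. t \<in> ball t0 r \<Longrightarrow> poly p (exp t) = c"
  shows "p = [:c:]"
proof (rule ccontr)
  assume "p \<noteq> [:c:]"
  then have "finite {x. poly (p - [:c:]) x = 0}"
    by (intro poly_roots_finite) simp
  moreover have "exp ` ball t0 r \<subseteq> {x. poly (p - [:c:]) x = 0}"
    using const by auto
  ultimately have "finite (exp ` ball t0 r)"
    using finite_subset by blast
  moreover have "open (exp ` ball t0 r)"
  proof (rule open_mapping_thm2[of exp UNIV])
      fix X :: "complex set" assume "open X" "X \<noteq> {}"
      show "\<not> exp constant_on X"
      proof
        assume "(exp :: complex \<Rightarrow> complex) constant_on X"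
        then obtain c where c: "\<And>x. x \<in> X \<Longrightarrow> exp x = (c :: complex)"
          by (auto simp: constant_on_def)
        obtain x where "x \<in> X" using \<open>X \<noteq> {}\<close> by auto
        have "(exp has_field_derivative 0) (at x)"
          using DERIV_const[of c "at x"] \<open>open X\<close> \<open>x \<in> X\<close>
          by (rule has_field_derivative_transform_within_open) (simp add: c)
        from DERIV_unique[OF this DERIV_exp] show False by simp
      qed
  qed (auto intro: holomorphic_intros)
  ultimately have "exp ` ball t0 r = {}"
    using finite_imp_not_open by blast
  then show False using \<open>0 < r\<close> by simp
qed

definition h_coeff :: "nat \<Rightarrow> qh_poly \<Rightarrow> complex poly" where
  "h_coeff d p = map_poly (\<lambda>c. coeff c d) p"

lemma coeff_h_coeff: "coeff (h_coeff d p) a = coeff (coeff p a) d"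
  by (simp add: h_coeff_def coeff_map_poly)

lemma poly_h_coeff: "poly (h_coeff d p) q = coeff (poly p [:q:]) d"
  by (induction p) (simp_all add: h_coeff_def map_poly_pCons)

text \<open>The uniqueness at the heart of the theorem. Suppose that the frame \<open>H = F w\<close> satisfies
  \<open>dH = (1/h) H A dt\<close> with \<open>A\<close> independent of \<open>h\<close>, that \<open>F\<close> is normalized at \<open>h = \<infinity>\<close>, and that \<open>w\<close> is
  polynomial in \<open>h\<close> and \<open>q\<close> with \<open>w = 1\<close> at \<open>q = 0\<close>. Then \<open>H(t) Z(t, 1/h) = H(t0)\<close> near \<open>t0\<close>, that is,
  \<open>F(t) w(t) Z(t, 1/h) = F(t0) w(t0)\<close>, and the comparison of growth at \<open>h = \<infinity>\<close> shows that the
  coefficient of the top power of \<open>h\<close> in \<open>w\<close> does not depend on \<open>t\<close>. Being polynomial in \<open>q\<close>, it is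
  equal to its value at \<open>q = 0\<close>, which is zero for a positive power of \<open>h\<close>. So \<open>w\<close> has degree \<open>0\<close> in \<open>h\<close>,
  and the same argument in degree \<open>0\<close> gives \<open>w = 1\<close>. The argument compares the
  values of \<open>F\<close> at two points instead of differentiating \<open>F\<close>, because the extensions to \<open>1 < norm h\<close> for
  different \<open>t\<close> are related only through the unit circle.\<close>

lemma identity_if_normalized_at_infinity:
  fixes w :: "nat \<Rightarrow> nat \<Rightarrow> qh_poly" and A :: "nat \<Rightarrow> nat \<Rightarrow> complex \<Rightarrow> complex"
    and F :: "complex \<Rightarrow> nat \<Rightarrow> nat \<Rightarrow> complex \<Rightarrow> complex"
  assumes V: "open V" "t0 \<in> V"
    and A: "\<And>i j. A i j holomorphic_on UNIV"
    and w0: "\<And>i j. i < n \<Longrightarrow> j < n \<Longrightarrow> poly (w i j) 0 = (if i = j then 1 else 0)"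
    and F: "\<And>t i j. t \<in> V \<Longrightarrow> i < n \<Longrightarrow> j < n \<Longrightarrow> continuous_on {h. 1 \<le> norm h} (F t i j)"
      "\<And>t i j. t \<in> V \<Longrightarrow> i < n \<Longrightarrow> j < n \<Longrightarrow> F t i j holomorphic_on {h. 1 < norm h}"
      "\<And>t i j. t \<in> V \<Longrightarrow> i < n \<Longrightarrow> j < n \<Longrightarrow> (F t i j \<longlongrightarrow> (if i = j then 1 else 0)) at_infinity"
    and H: "\<And>h t i j. H h i j t = (\<Sum>k<n. F t i k h * eval_qh (w k j) (exp t) h)"
    and deriv: "\<And>t h i j. t \<in> V \<Longrightarrow> norm h = 1 \<Longrightarrow> i < n \<Longrightarrow> j < n \<Longrightarrow>
      (H h i j has_field_derivative (\<Sum>l<n. H h i l t * A l j t) / h) (at t)"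
    and ij: "i < n" "j < n"
  shows "w i j = (if i = j then 1 else 0)"
proof -
  obtain r Z where r: "0 < r" "ball t0 r \<subseteq> V"
    and Z_hol: "\<And>i j t. i < n \<Longrightarrow> t \<in> ball t0 r \<Longrightarrow> Z i j t holomorphic_on ball 0 (3/2)"
    and Z_0: "\<And>i j t. Z i j t 0 = (if i = j then 1 else 0)"
    and Z_t0: "\<And>i j z. Z i j t0 z = (if i = j then 1 else 0)"
    and Z_deriv: "\<And>i j t z. i < n \<Longrightarrow> t \<in> ball t0 r \<Longrightarrow> norm z \<le> 1 \<Longrightarrow>
       ((\<lambda>s. Z i j s z) has_field_derivative - (z * (\<Sum>k<n. A i k t * Z k j t z))) (at t)"
    by (rule parallel_frame_near[OF A V, where n = n]) (rule that)
  have t0: "t0 \<in> ball t0 r" using r by simp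
  have pairing: "(\<Sum>k<n. F t i k h * (\<Sum>l<n. poly (poly (w k l) [:exp t:]) h * Z l j t (inverse h)))
      = (\<Sum>k<n. F t0 i k h * poly (poly (w k j) [:exp t0:]) h)"
    if t: "t \<in> ball t0 r" and h: "norm h = 1" and ij: "i < n" "j < n" for t h i j
  proof -
    have "(\<Sum>k<n. F t i k h * (\<Sum>l<n. poly (poly (w k l) [:exp t:]) h * Z l j t (inverse h)))
        = (\<Sum>k<n. \<Sum>l<n. F t i k h * poly (poly (w k l) [:exp t:]) h * Z l j t (inverse h))"
      by (simp add: sum_distrib_left mult.assoc)
    also have "\<dots> = (\<Sum>l<n. \<Sum>k<n. F t i k h * poly (poly (w k l) [:exp t:]) h * Z l j t (inverse h))"
      by (rule sum.swap)
    also have "\<dots> = (\<Sum>l<n. H h i l t * Z l j t (inverse h))"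
      by (simp add: H eval_qh_def sum_distrib_right)
    also have "\<dots> = (\<Sum>l<n. H h i l t0 * Z l j t0 (inverse h))"
    proof (rule parallel_pairing_constant[where S = "ball t0 r" and B = "\<lambda>k l t. A k l t / h"])
      show "(H h i l has_field_derivative (\<Sum>m<n. H h i m t * (A m l t / h))) (at t)"
        if "l < n" "t \<in> ball t0 r" for l t
        using deriv[of t h i l] that r h ij by (auto simp: sum_divide_distrib)
      show "((\<lambda>t. Z l j t (inverse h)) has_field_derivative - (\<Sum>m<n. A l m t / h * Z m j t (inverse h))) (at t)"
        if "l < n" "t \<in> ball t0 r" for l t
        using Z_deriv[OF that, of "inverse h" j] h
        by (simp add: norm_inverse norm_divide sum_distrib_left field_simps)
    qed (use t t0 in auto)
    also have "\<dots> = H h i j t0"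
      using ij by (simp add: Z_t0 if_distrib[of "\<lambda>c. _ * c"] cong: if_cong)
    finally show ?thesis by (simp add: H eval_qh_def)
  qed
  define vanishes_above where "vanishes_above d \<longleftrightarrow> (\<forall>i<n. \<forall>j<n. \<forall>b>d. h_coeff b (w i j) = 0)" for d
  have layer_const: "h_coeff d (w i j) = [:if i = j \<and> d = 0 then 1 else 0:]"
    if "vanishes_above d" and ij: "i < n" "j < n" for d i j
  proof -
    have deg: "degree (poly (w i j) [:q:]) \<le> d" if "i < n" "j < n" for i j q
      using \<open>vanishes_above d\<close> that by (intro degree_le) (auto simp: vanishes_above_def simp flip: poly_h_coeff)
    have "poly (h_coeff d (w i j)) (exp t) = poly (h_coeff d (w i j)) (exp t0)"
      if t: "t \<in> ball t0 r" for t
    proof -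
      have tV: "t \<in> V" "t0 \<in> V" using t V r by auto
      show ?thesis
        unfolding poly_h_coeff
      proof (rule leading_coefficients_agree[where Z = "\<lambda>i j. Z i j t" and F = "F t" and G = "F t0"
              and P = "\<lambda>i j. poly (w i j) [:exp t:]" and Q = "\<lambda>i j. poly (w i j) [:exp t0:]"])
        fix i j assume ij: "i < n" "j < n"
        show "continuous_on (cball 0 1) (Z i j t)"
          by (intro holomorphic_on_imp_continuous_on holomorphic_on_subset[OF Z_hol[OF ij(1) t]]) auto
        show "Z i j t holomorphic_on ball 0 1"
          by (intro holomorphic_on_subset[OF Z_hol[OF ij(1) t]]) auto
        show "(Z i j t \<longlongrightarrow> (if i = j then 1 else 0)) (at 0)"
        proof -
          have "isCont (Z i j t) 0"
            using holomorphic_on_imp_continuous_on[OF Z_hol[OF ij(1) t]]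
            by (simp add: continuous_on_eq_continuous_at)
          then show ?thesis by (simp add: isCont_def Z_0)
        qed
      qed (assumption | rule F[OF tV(1)] F[OF tV(2)] deg pairing[OF t] ij)+
    qed
    from poly_eq_const_if_constant_on_exp_ball[OF r(1) this]
    have const: "h_coeff d (w i j) = [:poly (h_coeff d (w i j)) (exp t0):]"
      by blast
    have "poly (h_coeff d (w i j)) 0 = (if i = j \<and> d = 0 then 1 else 0)"
      using w0[OF ij] by (simp add: poly_h_coeff coeff_1)
    then have "poly (h_coeff d (w i j)) (exp t0) = (if i = j \<and> d = 0 then 1 else 0)"
      by (subst (asm) const) simp
    then show ?thesis using const by simp
  qed
  have "\<exists>d. vanishes_above d"
  proof -
    define D where "D = (\<Sum>i<n. \<Sum>j<n. \<Sum>a\<le>degree (w i j). degree (coeff (w i j) a))"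
    have "h_coeff b (w i j) = 0" if "i < n" "j < n" "D < b" for i j b
    proof (rule poly_eqI)
      fix a
      show "coeff (h_coeff b (w i j)) a = coeff 0 a"
      proof (cases "a \<le> degree (w i j)")
        case True
        have "degree (coeff (w i j) a) \<le> (\<Sum>a\<le>degree (w i j). degree (coeff (w i j) a))"
          using True by (intro member_le_sum) auto
        also have "\<dots> \<le> (\<Sum>j<n. \<Sum>a\<le>degree (w i j). degree (coeff (w i j) a))"
          using that by (intro member_le_sum[of j]) auto
        also have "\<dots> \<le> D"
          unfolding D_def using that by (intro member_le_sum[of i]) auto
        finally show ?thesis using that by (simp add: coeff_h_coeff coeff_eq_0)
      qed (simp add: coeff_h_coeff coeff_eq_0)
    qed
    then show ?thesis unfolding vanishes_above_def by blast
  qed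
  define D where "D = (LEAST d. vanishes_above d)"
  have "vanishes_above D" unfolding D_def by (rule LeastI_ex) fact
  have "D = 0"
  proof (cases D)
    case (Suc d)
    have "vanishes_above d"
      unfolding vanishes_above_def
    proof (intro allI impI)
      fix i j b assume ij: "i < n" "j < n" and "d < b"
      show "h_coeff b (w i j) = 0"
      proof (cases "b = D")
        case True
        then show ?thesis using layer_const[OF \<open>vanishes_above D\<close> ij] Suc by simp
      next
        case False
        then have "D < b" using \<open>d < b\<close> Suc by simp
        then show ?thesis using \<open>vanishes_above D\<close> ij unfolding vanishes_above_def by blast
      qed
    qed
    then have "D \<le> d" unfolding D_def by (rule Least_le)
    then show ?thesis using Suc by simp
  qed
  with \<open>vanishes_above D\<close> have vanishes_above_0: "vanishes_above 0" by simp
  show ?thesis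
  proof (intro poly_eqI)
    fix a b
    have "coeff (h_coeff b (w i j)) a = (if i = j \<and> a = 0 \<and> b = 0 then 1 else 0)"
    proof (cases "b = 0")
      case True
      then show ?thesis using layer_const[OF vanishes_above_0 ij] by (simp add: coeff_pCons split: nat.split)
    next
      case False
      then have "h_coeff b (w i j) = 0" using vanishes_above_0 ij unfolding vanishes_above_def by blast
      then show ?thesis using False by simp
    qed
    then show "coeff (coeff (w i j) a) b = coeff (coeff (if i = j then 1 else 0) a) b"
      by (auto simp: coeff_h_coeff coeff_1)
  qed
qed

section \<open>Connection forms and logarithmic derivatives\<close>

lemma eval_qh_add: "eval_qh (p + r) q h = eval_qh p q h + eval_qh r q h"
  and eval_qh_mult: "eval_qh (p * r) q h = eval_qh p q h * eval_qh r q h"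
  and eval_qh_0: "eval_qh 0 q h = 0"
  and eval_qh_1: "eval_qh 1 q h = 1"
  and eval_qh_q_var: "eval_qh q_var q h = q"
  and eval_qh_h_var: "eval_qh h_var q h = h"
  by (simp_all add: eval_qh_def)

lemma eval_qh_sum: "eval_qh (sum p I) q h = (\<Sum>i\<in>I. eval_qh (p i) q h)"
  by (induction I rule: infinite_finite_induct) (simp_all add: eval_qh_0 eval_qh_add)

lemma eval_qh_deriv:
  "((\<lambda>t. eval_qh p (exp t) h) has_field_derivative exp t * eval_qh (pderiv p) (exp t) h) (at t)"
proof -
  have "((\<lambda>q. eval_qh p q h) has_field_derivative eval_qh (pderiv p) q h) (at q)" for q
  proof (induction p)
    case (pCons a p)
    have "eval_qh (pCons a p) q h = poly a h + q * eval_qh p q h" for q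
      by (simp add: eval_qh_def)
    moreover have "eval_qh (pderiv (pCons a p)) q h = eval_qh p q h + q * eval_qh (pderiv p) q h"
      by (simp add: eval_qh_def pderiv_pCons)
    ultimately show ?case by (auto intro!: derivative_eq_intros pCons.IH)
  qed (simp add: eval_qh_def)
  from DERIV_chain2[OF this DERIV_exp] show ?thesis by (simp add: mult.commute)
qed

lemma mat_inverse_invertible:
  fixes M :: "complex mat"
  assumes "M \<in> carrier_mat n n" "invertible_mat M"
  shows "the (mat_inverse M) \<in> carrier_mat n n" "the (mat_inverse M) * M = 1\<^sub>m n" "M * the (mat_inverse M) = 1\<^sub>m n"
proof -
  obtain B where B: "M * B = 1\<^sub>m (dim_row M)" "B * M = 1\<^sub>m (dim_row B)"
    using assms(2) unfolding invertible_mat_def inverts_mat_def by blast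
  have "dim_col B = n" using arg_cong[OF B(1), of dim_col] assms(1) by simp
  moreover have "dim_row B = n" using arg_cong[OF B(2), of dim_col] assms(1) by simp
  ultimately have "M \<in> Units (ring_mat TYPE(complex) n ())"
    using B assms(1) by (auto simp: Units_def ring_mat_def)
  then obtain B where "mat_inverse M = Some B"
    using mat_inverse(1)[OF assms(1), of "()"] by (cases "mat_inverse M") auto
  with mat_inverse(2)[OF assms(1) this]
  show "the (mat_inverse M) \<in> carrier_mat n n" "the (mat_inverse M) * M = 1\<^sub>m n" "M * the (mat_inverse M) = 1\<^sub>m n"
    by auto
qed

lemma log_deriv_eq_iff:
  assumes A: "A t \<in> carrier_mat n n" "invertible_mat (A t)" and B: "B \<in> carrier_mat n n"
    and diff: "\<And>i j. i < n \<Longrightarrow> j < n \<Longrightarrow> (\<lambda>s. A s $$ (i, j)) field_differentiable at t"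
  shows "log_deriv A t = B \<longleftrightarrow>
    (\<forall>i<n. \<forall>j<n. ((\<lambda>s. A s $$ (i, j)) has_field_derivative (\<Sum>l<n. A t $$ (i, l) * B $$ (l, j))) (at t))"
proof -
  note inv = mat_inverse_invertible[OF A]
  have D: "mat_deriv A t \<in> carrier_mat n n" using A by (simp add: mat_deriv_def)
  have "log_deriv A t = B \<longleftrightarrow> mat_deriv A t = A t * B"
  proof
    assume "log_deriv A t = B"
    then have "A t * B = (A t * the (mat_inverse (A t))) * mat_deriv A t"
      unfolding log_deriv_def using assoc_mult_mat[OF A(1) inv(1) D] by simp
    then show "mat_deriv A t = A t * B" using inv D by simp
  next
    assume "mat_deriv A t = A t * B"
    then have "log_deriv A t = (the (mat_inverse (A t)) * A t) * B"
      unfolding log_deriv_def using assoc_mult_mat[OF inv(1) A(1) B] by simp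
    then show "log_deriv A t = B" using inv B by simp
  qed
  also have "\<dots> \<longleftrightarrow> (\<forall>i<n. \<forall>j<n. deriv (\<lambda>s. A s $$ (i, j)) t = (\<Sum>l<n. A t $$ (i, l) * B $$ (l, j)))"
    using A B by (auto simp: mat_eq_iff mat_deriv_def scalar_prod_def lessThan_atLeast0)
  also have "\<dots> \<longleftrightarrow> (\<forall>i<n. \<forall>j<n. ((\<lambda>s. A s $$ (i, j)) has_field_derivative (\<Sum>l<n. A t $$ (i, l) * B $$ (l, j))) (at t))"
  proof -
    have "deriv (\<lambda>s. A s $$ (i, j)) t = x \<longleftrightarrow> ((\<lambda>s. A s $$ (i, j)) has_field_derivative x) (at t)"
      if "i < n" "j < n" for i j x
      using diff[OF that] DERIV_deriv_iff_field_differentiable DERIV_imp_deriv by blast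
    then show ?thesis by simp
  qed
  finally show ?thesis .
qed

text \<open>Homogeneity makes the matrix upper Hessenberg: in \<open>(1/h) R\<close> every degree is at least \<open>-2\<close>, since
  \<open>q\<close> and \<open>h\<close> have positive degree, whereas an entry below the subdiagonal would need degree at most \<open>-4\<close>.\<close>

lemma adapted_forms_entries:
  assumes R: "R \<in> adapted_forms N k" and "k < N"
  shows "R \<in> carrier_mat (N - 1) (N - 1)"
    and "\<And>\<alpha> \<beta>. \<alpha> < N - 1 \<Longrightarrow> \<beta> < N - 1 \<Longrightarrow> poly (R $$ (\<alpha>, \<beta>)) 0 = (if \<alpha> = Suc \<beta> then 1 else 0)"
    and "\<And>\<beta>. Suc \<beta> < N - 1 \<Longrightarrow> R $$ (Suc \<beta>, \<beta>) = 1"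
    and "\<And>\<alpha> \<beta>. Suc \<beta> < \<alpha> \<Longrightarrow> \<alpha> < N - 1 \<Longrightarrow> R $$ (\<alpha>, \<beta>) = 0"
proof -
  have hom: "homogeneous_mat N k (- 1) R" and q0: "at_q0 R = I_minus1 (N - 1)"
    and diag: "diagonal_part (- 1) R = I_minus1 (N - 1)" and c: "R \<in> carrier_mat (N - 1) (N - 1)"
    using R by (auto simp: adapted_forms_def)
  show "R \<in> carrier_mat (N - 1) (N - 1)" by (rule c)
  show "poly (R $$ (\<alpha>, \<beta>)) 0 = (if \<alpha> = Suc \<beta> then 1 else 0)" if "\<alpha> < N - 1" "\<beta> < N - 1" for \<alpha> \<beta>
    using arg_cong[OF q0, of "\<lambda>M. M $$ (\<alpha>, \<beta>)"] that c by (simp add: at_q0_def I_minus1_def)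
  show "R $$ (Suc \<beta>, \<beta>) = 1" if "Suc \<beta> < N - 1" for \<beta>
    using arg_cong[OF diag, of "\<lambda>M. M $$ (Suc \<beta>, \<beta>)"] that c by (simp add: diagonal_part_def I_minus1_def)
  show "R $$ (\<alpha>, \<beta>) = 0" if "Suc \<beta> < \<alpha>" "\<alpha> < N - 1" for \<alpha> \<beta>
  proof (rule ccontr)
    assume nz: "R $$ (\<alpha>, \<beta>) \<noteq> 0"
    define n where "n = int \<beta> - int \<alpha>"
    have entry: "diagonal_part n R $$ (\<alpha>, \<beta>) = R $$ (\<alpha>, \<beta>)"
      using that c by (simp add: diagonal_part_def n_def)
    have "homogeneous_of_degree N k (- 1) (R $$ (\<alpha>, \<beta>)) (2 * n)"
      using hom nz that c unfolding homogeneous_mat_def entry[symmetric] by auto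
    moreover obtain a b where "coeff (coeff (R $$ (\<alpha>, \<beta>)) a) b \<noteq> 0"
      using nz by (metis leading_coeff_0_iff)
    ultimately have "2 * (int N - int k) * int a + 2 * (int b + - 1) = 2 * n"
      unfolding homogeneous_of_degree_def by blast
    then have "2 * ((int N - int k) * int a) = 2 * n + 2 - 2 * int b"
      by (simp add: algebra_simps)
    moreover have "0 \<le> (int N - int k) * int a" using \<open>k < N\<close> by simp
    moreover have "n \<le> - 2" using that by (simp add: n_def)
    ultimately show False by (smt (verit) of_nat_0_le_iff)
  qed
qed

lemma h_inverse_linear_eval:
  assumes "h_inverse_linear R" "R \<in> carrier_mat n n" "i < n" "j < n" "norm h = 1"
  shows "eval_qh (R $$ (i, j)) (exp t) h = eval_qh (R $$ (i, j)) (exp t) 1"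
proof -
  have "h \<cdot>\<^sub>m connection_form R t h = 1 \<cdot>\<^sub>m connection_form R t 1"
    by (rule assms(1)[unfolded h_inverse_linear_def, rule_format]) (use assms(5) in auto)
  from arg_cong[OF this, of "\<lambda>M. M $$ (i, j)"] show ?thesis
    using assms(2-5) by (cases "h = 0") (auto simp: connection_form_def eval_mat_def)
qed

lemma connection_form_carrier:
  "R \<in> carrier_mat n n \<Longrightarrow> connection_form R t h \<in> carrier_mat n n"
  by (simp add: connection_form_def eval_mat_def)

lemma connection_form_entry:
  "R \<in> carrier_mat n n \<Longrightarrow> i < n \<Longrightarrow> j < n \<Longrightarrow>
    connection_form R t h $$ (i, j) = eval_qh (R $$ (i, j)) (exp t) h / h"
  by (simp add: connection_form_def eval_mat_def)

text \<open>The rule \<open>(L T)^(-1) d(L T) = T^(-1) (P/h) T dt + T^(-1) dT\<close>, stated for one row of \<open>L\<close> and without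
  inverses: the hypothesis on \<open>T\<close> is \<open>P T + h dT/dt = T R\<close>, with \<open>d/dt = q d/dq\<close>.\<close>

lemma gauge_transformed_frame:
  fixes L :: "nat \<Rightarrow> complex \<Rightarrow> complex" and T P R :: "nat \<Rightarrow> nat \<Rightarrow> qh_poly"
  assumes L: "\<And>l. l < n \<Longrightarrow> (L l has_field_derivative (\<Sum>m<n. L m t * (eval_qh (P m l) (exp t) h / h))) (at t)"
    and gauge: "\<And>l. l < n \<Longrightarrow> (\<Sum>m<n. P l m * T m j) + h_var * q_var * pderiv (T l j) = (\<Sum>m<n. T l m * R m j)"
    and "h \<noteq> 0"
  shows "((\<lambda>s. \<Sum>l<n. L l s * eval_qh (T l j) (exp s) h) has_field_derivative
    (\<Sum>m<n. (\<Sum>l<n. L l t * eval_qh (T l m) (exp t) h) * eval_qh (R m j) (exp t) h) / h) (at t)"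
proof -
  let ?e = "\<lambda>p. eval_qh p (exp t) h"
  have step: "?e (P m l) / h * x = ?e (P m l) * x / h" for m l x by simp
  have "((\<lambda>s. \<Sum>l<n. L l s * eval_qh (T l j) (exp s) h) has_field_derivative
      (\<Sum>l<n. (\<Sum>m<n. L m t * (?e (P m l) / h)) * ?e (T l j) + (exp t * ?e (pderiv (T l j))) * L l t)) (at t)"
    by (intro DERIV_sum DERIV_mult L eval_qh_deriv) simp
  also have "(\<Sum>l<n. (\<Sum>m<n. L m t * (?e (P m l) / h)) * ?e (T l j) + (exp t * ?e (pderiv (T l j))) * L l t)
     = (\<Sum>l<n. \<Sum>m<n. L m t * (?e (P m l) * ?e (T l j))) / h + (\<Sum>l<n. L l t * (exp t * ?e (pderiv (T l j))))"
    by (simp add: sum.distrib sum_distrib_left sum_distrib_right sum_divide_distrib mult_ac)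
  also have "(\<Sum>l<n. \<Sum>m<n. L m t * (?e (P m l) * ?e (T l j))) = (\<Sum>m<n. \<Sum>l<n. L m t * (?e (P m l) * ?e (T l j)))"
    by (rule sum.swap)
  also have "\<dots> / h + (\<Sum>l<n. L l t * (exp t * ?e (pderiv (T l j)))) =
      (\<Sum>l<n. L l t * ((\<Sum>m<n. ?e (P l m) * ?e (T m j)) + h * exp t * ?e (pderiv (T l j)))) / h"
    using \<open>h \<noteq> 0\<close> by (simp add: distrib_left sum.distrib sum_distrib_left add_divide_distrib sum_divide_distrib mult_ac)
  also have "\<dots> = (\<Sum>l<n. L l t * (\<Sum>m<n. ?e (T l m) * ?e (R m j))) / h"
  proof -
    have "(\<Sum>m<n. ?e (P l m) * ?e (T m j)) + h * exp t * ?e (pderiv (T l j)) = (\<Sum>m<n. ?e (T l m) * ?e (R m j))"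
      if "l < n" for l
      using arg_cong[OF gauge[OF that], of ?e]
      by (simp only: eval_qh_add eval_qh_mult eval_qh_sum eval_qh_q_var eval_qh_h_var)
    then show ?thesis by simp
  qed
  also have "(\<Sum>l<n. L l t * (\<Sum>m<n. ?e (T l m) * ?e (R m j))) = (\<Sum>l<n. \<Sum>m<n. L l t * ?e (T l m) * ?e (R m j))"
    by (simp add: sum_distrib_left mult.assoc)
  also have "\<dots> = (\<Sum>m<n. \<Sum>l<n. L l t * ?e (T l m) * ?e (R m j))"
    by (rule sum.swap)
  finally show ?thesis by (simp add: sum_distrib_right)
qed

section \<open>Reduced operator and Birkhoff factorization\<close>

theorem theorem7p1:
  fixes N k :: nat
    and R :: "qh_poly mat"
    and V :: "complex set"
    and L Lm Lp :: "complex \<Rightarrow> complex \<Rightarrow> complex mat"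
    and U :: "qh_poly mat"
  assumes "N \<ge> 5" and "k \<ge> 1" and "N > k"
    and "R \<in> adapted_forms N k"
    and "reduced_operator N R = P_op N k"
    and "h_inverse_linear R"
    and "open V" and "V \<noteq> {}"
    and "integrates_form (N - 1) V L (PF_matrix N k)"
    and "\<forall>t \<in> V. birkhoff_factorization (N - 1) (L t) (Lm t) (Lp t)"
    and "U \<in> gauge_group_AD N k"
    and "\<forall>t \<in> V. \<forall>h \<in> sphere 0 1. Lp t h = eval_mat U (exp t) h"
  shows "\<forall>t \<in> V. \<forall>h \<in> sphere 0 1. connection_form R t h = log_deriv (\<lambda>s. Lm s h) t"
proof -
  define n where "n = N - 1"
  note R = adapted_forms_entries[OF assms(4,3), folded n_def]
  define P where "P = PF_matrix N k"
  have P: "P \<in> carrier_mat n n"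
  proof -
    obtain c where c: "\<And>f. P_op N k f = (h_partial ^^ (N - 1)) f - (\<Sum>i<N - 1. coef (c i) * (h_partial ^^ i) f)"
      using P_op_normal_form[OF assms(2,3)] by blast
    show ?thesis
      unfolding P_def PF_matrix_companion[OF assms(2,3) c] n_def by simp
  qed
  define T where "T i j = reduced_coeff R j i" for i j
  have T_0: "poly (T i j) 0 = (if i = j then 1 else 0)" if "j < n" for i j
    unfolding T_def by (rule reduced_coeff_q0[of n]) (use R(2) that in auto)
  have intertwines: "(\<Sum>m<n. P $$ (l, m) * T m j) + h_var * q_var * pderiv (T l j) = (\<Sum>m<n. T l m * R $$ (m, j))"
    if "l < n" "j < n" for l j
    unfolding T_def P_def n_def
    by (rule reduced_coeff_intertwines[OF assms(2,3,5) R(4,3)[unfolded n_def]]) (use that n_def in auto)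
  have U: "U \<in> carrier_mat n n" and U_q0: "at_q0 U = 1\<^sub>m n"
    using assms(11) by (auto simp: gauge_group_AD_def n_def)
  have U_0: "poly (U $$ (i, j)) 0 = (if i = j then 1 else 0)" if "i < n" "j < n" for i j
    using arg_cong[OF U_q0, of "\<lambda>M. M $$ (i, j)"] that U by (simp add: at_q0_def)
  \<comment> \<open>\<open>w\<close> is the matrix \<open>U T\<close>, so that \<open>L T = Lm w\<close> on the unit circle.\<close>
  define w where "w i j = (\<Sum>m<n. U $$ (i, m) * T m j)" for i j
  have w_0: "poly (w i j) 0 = (if i = j then 1 else 0)" if "i < n" "j < n" for i j
    using that by (simp add: w_def poly_sum U_0 T_0 if_distrib[of "\<lambda>c. c * _"] cong: if_cong)
  \<comment> \<open>On the unit circle \<open>R\<close> does not depend on \<open>h\<close>, so its value at \<open>h = 1\<close> serves for all \<open>h\<close>; entries outside the matrix are set to \<open>0\<close> to be entire.\<close>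
  define A where "A i j t = (if i < n \<and> j < n then eval_qh (R $$ (i, j)) (exp t) 1 else 0)" for i j t
  have A_hol: "A i j holomorphic_on UNIV" for i j
  proof -
    have "(\<lambda>t. eval_qh p (exp t) 1) holomorphic_on UNIV" for p
      unfolding holomorphic_on_open[OF open_UNIV] using eval_qh_deriv by blast
    then show ?thesis by (cases "i < n"; cases "j < n") (simp_all add: A_def[abs_def])
  qed
  have "\<forall>t\<in>V. \<exists>F. extends_hol n {h. 1 \<le> norm h} (Lm t) F \<and>
      (\<forall>i<n. \<forall>j<n. ((\<lambda>h. F h $$ (i, j)) \<longlongrightarrow> 1\<^sub>m n $$ (i, j)) at_infinity)"
    using assms(10) unfolding birkhoff_factorization_def n_def by blast
  from bchoice[OF this] obtain F where
    F_ext: "\<And>t. t \<in> V \<Longrightarrow> extends_hol n {h. 1 \<le> norm h} (Lm t) (F t)" and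
    F_lim: "\<And>t i j. t \<in> V \<Longrightarrow> i < n \<Longrightarrow> j < n \<Longrightarrow> ((\<lambda>h. F t h $$ (i, j)) \<longlongrightarrow> 1\<^sub>m n $$ (i, j)) at_infinity"
    by blast
  have F_Lm: "F t h = Lm t h" if "t \<in> V" "norm h = 1" for t h
    using F_ext[OF that(1)] that(2) by (simp add: extends_hol_def)
  have Lm: "Lm t h \<in> carrier_mat n n" "invertible_mat (Lm t h)" if "t \<in> V" "norm h = 1" for t h
    using assms(10) that by (auto simp: birkhoff_factorization_def loop_group_def n_def)
  have L: "L t h \<in> carrier_mat n n" "invertible_mat (L t h)" if "t \<in> V" "norm h = 1" for t h
    using assms(10) that by (auto simp: birkhoff_factorization_def loop_group_def n_def)
  have L_entry: "L t h $$ (i, j) = (\<Sum>k<n. F t h $$ (i, k) * eval_qh (U $$ (k, j)) (exp t) h)"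
    if "t \<in> V" "norm h = 1" "i < n" "j < n" for t h i j
  proof -
    have "L t h = Lm t h * eval_mat U (exp t) h"
      using assms(10,12) that by (auto simp: birkhoff_factorization_def)
    then show ?thesis
      using that Lm[OF that(1,2)] U by (simp add: F_Lm eval_mat_def scalar_prod_def lessThan_atLeast0)
  qed
  have L_deriv: "((\<lambda>s. L s h $$ (i, j)) has_field_derivative
      (\<Sum>m<n. L t h $$ (i, m) * (eval_qh (P $$ (m, j)) (exp t) h / h))) (at t)"
    if "t \<in> V" "norm h = 1" "i < n" "j < n" for t h i j
  proof -
    have "(\<lambda>s. L s h $$ (i, j)) field_differentiable at t" if "i < n" "j < n" for i j
      using assms(9) that \<open>t \<in> V\<close> \<open>norm h = 1\<close> by (auto simp: integrates_form_def n_def)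
    note iff = log_deriv_eq_iff[of "\<lambda>s. L s h", OF L[OF that(1,2)] connection_form_carrier[OF P] this]
    have "log_deriv (\<lambda>s. L s h) t = connection_form P t h"
      using assms(9) that by (auto simp: integrates_form_def P_def)
    then show ?thesis
      using iff that P by (simp add: connection_form_entry cong: sum.cong_simp)
  qed
  \<comment> \<open>The frame \<open>H = Lm w = L T\<close>: the first form has the normalized factor, the second satisfies the equation of \<open>R\<close>.\<close>
  define H where "H h i j s = (\<Sum>k<n. F s h $$ (i, k) * eval_qh (w k j) (exp s) h)" for h i j s
  have H_L: "H h i j s = (\<Sum>m<n. L s h $$ (i, m) * eval_qh (T m j) (exp s) h)"
    if "s \<in> V" "norm h = 1" "i < n" for h i j s
  proof -
    have "H h i j s = (\<Sum>k<n. \<Sum>m<n. F s h $$ (i, k) * eval_qh (U $$ (k, m)) (exp s) h * eval_qh (T m j) (exp s) h)"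
      by (simp add: H_def w_def eval_qh_sum eval_qh_mult sum_distrib_left mult.assoc)
    also have "\<dots> = (\<Sum>m<n. \<Sum>k<n. F s h $$ (i, k) * eval_qh (U $$ (k, m)) (exp s) h * eval_qh (T m j) (exp s) h)"
      by (rule sum.swap)
    finally show ?thesis using that by (simp add: L_entry sum_distrib_right)
  qed
  have H_deriv: "(H h i j has_field_derivative (\<Sum>l<n. H h i l t * A l j t) / h) (at t)"
    if "t \<in> V" "norm h = 1" "i < n" "j < n" for t h i j
  proof -
    have "h \<noteq> 0" using that by auto
    have "((\<lambda>s. \<Sum>m<n. L s h $$ (i, m) * eval_qh (T m j) (exp s) h) has_field_derivative
        (\<Sum>m<n. (\<Sum>l<n. L t h $$ (i, l) * eval_qh (T l m) (exp t) h) * eval_qh (R $$ (m, j)) (exp t) h) / h) (at t)"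
      by (rule gauge_transformed_frame[where L = "\<lambda>l s. L s h $$ (i, l)" and P = "\<lambda>l m. P $$ (l, m)"
            and R = "\<lambda>l m. R $$ (l, m)", OF L_deriv[OF that(1-3)] intertwines[OF _ that(4)] \<open>h \<noteq> 0\<close>])
    also have "(\<Sum>m<n. (\<Sum>l<n. L t h $$ (i, l) * eval_qh (T l m) (exp t) h) * eval_qh (R $$ (m, j)) (exp t) h)
        = (\<Sum>m<n. H h i m t * A m j t)"
      using that by (intro sum.cong refl) (simp add: H_L[OF that(1-3)] A_def h_inverse_linear_eval[OF assms(6) R(1) _ _ that(2)])
    finally show ?thesis
      by (rule has_field_derivative_transform_within_open[OF _ \<open>open V\<close>]) (simp_all add: H_L that)
  qed
  have w_id: "w i j = (if i = j then 1 else 0)" if ij: "i < n" "j < n" for i j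
  proof -
    obtain t0 where "t0 \<in> V" using assms(8) by blast
    show ?thesis
    proof (rule identity_if_normalized_at_infinity[where F = "\<lambda>t i j h. F t h $$ (i, j)",
          OF \<open>open V\<close> \<open>t0 \<in> V\<close> A_hol w_0 _ _ _ H_def H_deriv ij])
      fix t i j assume t: "t \<in> V" and ij: "i < n" "j < n"
      show "continuous_on {h. 1 \<le> norm h} (\<lambda>h. F t h $$ (i, j))"
        using F_ext[OF t] ij by (simp add: extends_hol_def)
      show "(\<lambda>h. F t h $$ (i, j)) holomorphic_on {h. 1 < norm h}"
      proof (rule holomorphic_on_subset)
        show "(\<lambda>h. F t h $$ (i, j)) holomorphic_on interior {h. 1 \<le> norm h}"
          using F_ext[OF t] ij by (simp add: extends_hol_def)
        show "{h :: complex. 1 < norm h} \<subseteq> interior {h. 1 \<le> norm h}"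
          by (intro interior_maximal open_Collect_less continuous_intros) auto
      qed
      show "((\<lambda>h. F t h $$ (i, j)) \<longlongrightarrow> (if i = j then 1 else 0)) at_infinity"
        using F_lim[OF t ij] ij by simp
    qed
  qed
  have H_Lm: "H h i j s = Lm s h $$ (i, j)" if "s \<in> V" "norm h = 1" "j < n" for h i j s
    using that by (simp add: H_def w_id F_Lm eval_qh_0 eval_qh_1 if_distrib[of "\<lambda>p. eval_qh p _ _"]
        if_distrib[of "\<lambda>c. _ * c"] cong: if_cong)
  show ?thesis
  proof (intro ballI)
    fix t h :: complex assume t: "t \<in> V" and "h \<in> sphere 0 1"
    then have h: "norm h = 1" by simp
    have deriv: "((\<lambda>s. Lm s h $$ (i, j)) has_field_derivative
        (\<Sum>l<n. Lm t h $$ (i, l) * connection_form R t h $$ (l, j))) (at t)" if "i < n" "j < n" for i j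
    proof (rule has_field_derivative_transform_within_open[OF _ \<open>open V\<close> t])
      show "H h i j s = Lm s h $$ (i, j)" if "s \<in> V" for s
        using H_Lm[OF that h \<open>j < n\<close>] .
      have "(\<Sum>l<n. H h i l t * A l j t) / h = (\<Sum>l<n. Lm t h $$ (i, l) * connection_form R t h $$ (l, j))"
        unfolding sum_divide_distrib
        using that by (intro sum.cong refl)
          (simp add: H_Lm[OF t h] A_def connection_form_entry[OF R(1)] h_inverse_linear_eval[OF assms(6) R(1) _ _ h])
      with H_deriv[OF t h that]
      show "(H h i j has_field_derivative (\<Sum>l<n. Lm t h $$ (i, l) * connection_form R t h $$ (l, j))) (at t)"
        by simp
    qed
    have "(\<lambda>s. Lm s h $$ (i, j)) field_differentiable at t" if "i < n" "j < n" for i j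
      using deriv[OF that] unfolding field_differentiable_def by blast
    note log_deriv_eq_iff[where A = "\<lambda>s. Lm s h", OF Lm[OF t h] connection_form_carrier[OF R(1)] this]
    then have "log_deriv (\<lambda>s. Lm s h) t = connection_form R t h"
      using deriv by blast
    then show "connection_form R t h = log_deriv (\<lambda>s. Lm s h) t" by simp
  qed
qed

end
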